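(* In the setting described in the context (in particular $w,\varepsilon_k$ Gaussian; $x_k$ identically distributed with bounded support and common positive-definite covariance matrix $\overline Q$), let $\hat w_k^\circ$ be the online (OLL) estimate of $w$ at time $k$ and $\mathrm{MSE}_k^\circ:=\mathbb{E}\{(w-\hat w_k^\circ)'(w-\hat w_k^\circ)\}$. Then the following hold. (i) $\mathrm{MSE}_k^\circ=\mathrm{Tr}\{\Sigma_{e_k^\circ}\}$. (ii) For $k\ge1$, $$\mathrm{MSE}_k^\circ\le\mathrm{Tr}\{(I+L_{k-1})\Sigma_{e_{k-1}^\circ}(I+L_{k-1})'\}+\mathrm{Tr}\{L_{k-1}\Sigma_{e_{k-1}^\dagger}L_{k-1}'\}+2\sqrt{\mathrm{Tr}\{(I+L_{k-1})\Sigma_{e_{k-1}^\circ}(I+L_{k-1})'\}\,\mathrm{Tr}\{L_{k-1}\Sigma_{e_{k-1}^\dagger}L_{k-1}'\}}.$$ (iii) In the infinite-horizon case (OLL estimates generated with the stationary matrix $L$ in place of $L_k$ for all $k$), $$\lim_{k\to+\infty}\mathrm{MSE}_k^\circ=\lim_{k\to+\infty}\mathbb{E}\{(w-\hat w_k^\circ)'(w-\hat w_k^\circ)\}=0.$$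
   Context: A prime denotes transpose, $I$ is the $d\times d$ identity matrix, $\gamma>0$, and (in the finite-horizon case) $N\ge1$ is an integer. Data model: $w\in\mathbb{R}^d$ is a random vector, $x_k\in\mathbb{R}^d$ and $\varepsilon_k\in\mathbb{R}$ ($k=0,1,\dots$) are random inputs and noises; the random variables $w,\{x_k\},\{\varepsilon_k\}$ are mutually independent and have mean $0$; $w$ has covariance matrix $\Sigma_w$ and the $\varepsilon_k$ have the same variance $\sigma_\varepsilon^2>0$; $w$ and the $\varepsilon_k$ are Gaussian; the $x_k$ are identically distributed, their common probability distribution has bounded support, and $\mathbb{E}\{x_kx_k'\}=\overline Q$ is positive-definite. The outputs are $y_k=w'x_k+\varepsilon_k$. Put $Q_k:=x_kx_k'$. Learning machine: $\hat w_0:=0$, $\hat w_{k+1}=\hat w_k+u_k$, where $u_k$ is a function of the information vector $I_k:=\{(x_j,y_j),\ j=0,\dots,k;\ u_j,\ j=0,\dots,k-1\}$ ($I_0:=\{(x_0,y_0)\}$). The error is $e_k:=\hat w_k-w$. OLL estimates: $\hat w_k^\circ$ denotes the estimates generated by the optimal updating functions $u_k^\circ=L_k\,\mathbb{E}\{e_k^\circ|I_k\}$, i.e. $\hat w_0^\circ=0$ and $\hat w_{k+1}^\circ=\hat w_k^\circ+L_k(\hat w_k^\circ-\hat w_k^\dagger)$, where $\hat w_k^\dagger:=\mathbb{E}\{w|I_k\}$ is the Kalman-filter estimate. Finite horizon $N$ (minimization of $\mathbb{E}\{\sum_{k=0}^{N-1}[e_k'Q_ke_k+\gamma u_k'u_k]+e_N'Q_Ne_N\}$):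 $L_k:=-(\overline K_{k+1}+\gamma I)^{-1}\overline K_{k+1}$ for $k=0,\dots,N-1$, with $\overline K_N=\mathbb{E}\{Q_N\}$ and $\overline K_k=\overline K_{k+1}-\overline K_{k+1}(\overline K_{k+1}+\gamma I)^{-1}\overline K_{k+1}+\mathbb{E}\{Q_k\}$. Infinite horizon (minimization of $\liminf_{N\to+\infty}\frac1N\mathbb{E}\{\sum_{k=0}^{N-1}[e_k'Q_ke_k+\gamma u_k'u_k]\}$): $L_k=L:=-(\overline K+\gamma I)^{-1}\overline K$ for all $k$, with $\overline K$ the symmetric positive-semidefinite solution of $\overline K=\overline K-\overline K(\overline K+\gamma I)^{-1}\overline K+\overline Q$. Put $e_k^\circ:=\hat w_k^\circ-w$, $e_k^\dagger:=\hat w_k^\dagger-w$; $\Sigma_{e_k^\circ}$ and $\Sigma_{e_k^\dagger}$ are the (unconditional) covariance matrices of $e_k^\circ$ and $e_k^\dagger$. *)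

theory Defs
  imports "HOL-Probability.Probability"
begin

section \<open>Matrices\<close>

definition outer :: "real ^ 'n \<Rightarrow> real ^ 'n \<Rightarrow> real ^ 'n ^ 'n" where
  "outer v z = (\<chi> i j. v $ i * z $ j)"

definition psd_matrix :: "real ^ 'n ^ 'n \<Rightarrow> bool" where
  "psd_matrix A \<longleftrightarrow> transpose A = A \<and> (\<forall>v. 0 \<le> v \<bullet> (A *v v))"

definition pd_matrix :: "real ^ 'n ^ 'n \<Rightarrow> bool" where
  "pd_matrix A \<longleftrightarrow> transpose A = A \<and> (\<forall>v. v \<noteq> 0 \<longrightarrow> 0 < v \<bullet> (A *v v))"

section \<open>Random vectors\<close>

text \<open>Expectations of random vectors and random matrices are Bochner integrals with values in
  \<^typ>\<open>real ^ 'n\<close> and \<^typ>\<open>real ^ 'n ^ 'n\<close>.\<close>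

definition covariance :: "'a measure \<Rightarrow> ('a \<Rightarrow> real ^ 'n) \<Rightarrow> real ^ 'n ^ 'n" where
  "covariance M X = (let m = (LINT \<omega>|M. X \<omega>) in LINT \<omega>|M. outer (X \<omega> - m) (X \<omega> - m))"

definition second_moment :: "'a measure \<Rightarrow> ('a \<Rightarrow> real ^ 'n) \<Rightarrow> real ^ 'n ^ 'n" where
  "second_moment M X = (LINT \<omega>|M. outer (X \<omega>) (X \<omega>))"

text \<open>A random vector is Gaussian if all its linear functionals are univariate Gaussian. A
  variance may be zero, so that singular covariance matrices are admitted.\<close>

definition gaussian_vector :: "'a measure \<Rightarrow> ('a \<Rightarrow> real ^ 'n) \<Rightarrow> bool" where
  "gaussian_vector M X \<longleftrightarrow> X \<in> borel_measurable M \<and>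
     (\<forall>a. (\<exists>c. AE \<omega> in M. a \<bullet> X \<omega> = c) \<or>
          (\<exists>\<mu> s. 0 < s \<and> distributed M lborel (\<lambda>\<omega>. a \<bullet> X \<omega>) (normal_density \<mu> s)))"

definition distribution_support :: "'b::topological_space measure \<Rightarrow> 'b set" where
  "distribution_support D = {z. \<forall>U. open U \<and> z \<in> U \<longrightarrow> 0 < emeasure D U}"

definition vec_cond_exp ::
    "'a measure \<Rightarrow> 'a measure \<Rightarrow> ('a \<Rightarrow> real ^ 'n) \<Rightarrow> 'a \<Rightarrow> real ^ 'n" where
  "vec_cond_exp M F X = (\<lambda>\<omega>. \<chi> i. real_cond_exp M F (\<lambda>\<omega>'. X \<omega>' $ i) \<omega>)"

section \<open>Data model\<close>

text \<open>The weight, the inputs and the noises have different codomains, so their mutual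
  independence is expressed by \<^const>\<open>prob_space.indep_sets\<close> for the sigma-algebras that they
  generate.\<close>

datatype source = Weight | Input nat | Noise nat

primrec source_events ::
    "'a measure \<Rightarrow> ('a \<Rightarrow> real ^ 'd) \<Rightarrow> (nat \<Rightarrow> 'a \<Rightarrow> real ^ 'd) \<Rightarrow> (nat \<Rightarrow> 'a \<Rightarrow> real) \<Rightarrow>
     source \<Rightarrow> 'a set set" where
  "source_events M w x \<epsilon> Weight = {w -` A \<inter> space M |A. A \<in> sets borel}"
| "source_events M w x \<epsilon> (Input k) = {x k -` A \<inter> space M |A. A \<in> sets borel}"
| "source_events M w x \<epsilon> (Noise k) = {\<epsilon> k -` A \<inter> space M |A. A \<in> sets borel}"

locale data_model = prob_space M
  for M :: "'a measure" +
  fixes w :: "'a \<Rightarrow> real ^ 'd"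
    and x :: "nat \<Rightarrow> 'a \<Rightarrow> real ^ 'd"
    and \<epsilon> :: "nat \<Rightarrow> 'a \<Rightarrow> real"
    and \<Sigma>w :: "real ^ 'd ^ 'd"
    and \<sigma> :: real
    and Qbar :: "real ^ 'd ^ 'd"
  assumes x_measurable: "\<And>k. x k \<in> borel_measurable M"
    and independent: "indep_sets (source_events M w x \<epsilon>) UNIV"
    and w_gaussian: "gaussian_vector M w"
    and w_mean: "expectation w = 0"
    and w_covariance: "covariance M w = \<Sigma>w"
    and \<sigma>_pos: "0 < \<sigma>"
    and noise_gaussian: "\<And>k. distributed M lborel (\<epsilon> k) (normal_density 0 \<sigma>)"
    and x_mean: "\<And>k. expectation (x k) = 0"
    and x_identical: "\<And>k. distr M borel (x k) = distr M borel (x 0)"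
    and x_bounded: "bounded (distribution_support (distr M borel (x 0)))"
    and x_second_moment: "\<And>k. second_moment M (x k) = Qbar"
    and Qbar_pd: "pd_matrix Qbar"

definition model_output ::
    "('a \<Rightarrow> real ^ 'd) \<Rightarrow> (nat \<Rightarrow> 'a \<Rightarrow> real ^ 'd) \<Rightarrow> (nat \<Rightarrow> 'a \<Rightarrow> real) \<Rightarrow> nat \<Rightarrow> 'a \<Rightarrow> real" where
  "model_output w x \<epsilon> k \<omega> = w \<omega> \<bullet> x k \<omega> + \<epsilon> k \<omega>"

section \<open>Learning machine\<close>

primrec estimate :: "(nat \<Rightarrow> 'a \<Rightarrow> real ^ 'd) \<Rightarrow> nat \<Rightarrow> 'a \<Rightarrow> real ^ 'd" where
  "estimate u 0 = (\<lambda>\<omega>. 0)"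
| "estimate u (Suc k) = (\<lambda>\<omega>. estimate u k \<omega> + u k \<omega>)"

definition est_error ::
    "('a \<Rightarrow> real ^ 'd) \<Rightarrow> (nat \<Rightarrow> 'a \<Rightarrow> real ^ 'd) \<Rightarrow> nat \<Rightarrow> 'a \<Rightarrow> real ^ 'd" where
  "est_error w u k = (\<lambda>\<omega>. estimate u k \<omega> - w \<omega>)"

definition mse :: "'a measure \<Rightarrow> ('a \<Rightarrow> real ^ 'd) \<Rightarrow> (nat \<Rightarrow> 'a \<Rightarrow> real ^ 'd) \<Rightarrow> nat \<Rightarrow> real" where
  "mse M w u k = (LINT \<omega>|M. (w \<omega> - estimate u k \<omega>) \<bullet> (w \<omega> - estimate u k \<omega>))"

text \<open>The sigma-algebra generated by the information vector at time \<open>k\<close>, that is, by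
  \<open>x j\<close> and \<open>y j\<close> for \<open>j \<le> k\<close> and by \<open>u j\<close> for \<open>j < k\<close>.\<close>

definition information ::
    "'a measure \<Rightarrow> (nat \<Rightarrow> 'a \<Rightarrow> real ^ 'd) \<Rightarrow> (nat \<Rightarrow> 'a \<Rightarrow> real) \<Rightarrow> (nat \<Rightarrow> 'a \<Rightarrow> real ^ 'd) \<Rightarrow>
     nat \<Rightarrow> 'a measure" where
  "information M x y u k = sigma (space M)
     ({x j -` A \<inter> space M |j A. j \<le> k \<and> A \<in> sets borel} \<union>
      {y j -` A \<inter> space M |j A. j \<le> k \<and> A \<in> sets borel} \<union>
      {u j -` A \<inter> space M |j A. j < k \<and> A \<in> sets borel})"

definition kalman_error ::
    "'a measure \<Rightarrow> ('a \<Rightarrow> real ^ 'd) \<Rightarrow> (nat \<Rightarrow> 'a \<Rightarrow> real ^ 'd) \<Rightarrow> (nat \<Rightarrow> 'a \<Rightarrow> real) \<Rightarrow>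
     (nat \<Rightarrow> 'a \<Rightarrow> real ^ 'd) \<Rightarrow> nat \<Rightarrow> 'a \<Rightarrow> real ^ 'd" where
  "kalman_error M w x \<epsilon> u k =
     (\<lambda>\<omega>. vec_cond_exp M (information M x (model_output w x \<epsilon>) u k) w \<omega> - w \<omega>)"

text \<open>The update rule \<open>u k = L k E{e k | I k}\<close> at the times in \<open>T\<close>. Being a function of the
  information vector is measurability with respect to the sigma-algebra it generates. Conditional
  expectations are determined only almost everywhere, so any version is allowed.\<close>

definition oll_updates ::
    "'a measure \<Rightarrow> ('a \<Rightarrow> real ^ 'd) \<Rightarrow> (nat \<Rightarrow> 'a \<Rightarrow> real ^ 'd) \<Rightarrow> (nat \<Rightarrow> 'a \<Rightarrow> real) \<Rightarrow>
     (nat \<Rightarrow> real ^ 'd ^ 'd) \<Rightarrow> nat set \<Rightarrow> (nat \<Rightarrow> 'a \<Rightarrow> real ^ 'd) \<Rightarrow> bool" where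
  "oll_updates M w x \<epsilon> L T u \<longleftrightarrow>
     (\<forall>k\<in>T. u k \<in> borel_measurable (information M x (model_output w x \<epsilon>) u k) \<and>
       (AE \<omega> in M. u k \<omega> =
          L k *v vec_cond_exp M (information M x (model_output w x \<epsilon>) u k) (est_error w u k) \<omega>))"

section \<open>Gain matrices\<close>

definition riccati_step :: "real \<Rightarrow> real ^ 'd ^ 'd \<Rightarrow> real ^ 'd ^ 'd \<Rightarrow> real ^ 'd ^ 'd" where
  "riccati_step \<gamma> Q K = K - K ** matrix_inv (K + \<gamma> *\<^sub>R mat 1) ** K + Q"

definition gain :: "real \<Rightarrow> real ^ 'd ^ 'd \<Rightarrow> real ^ 'd ^ 'd" where
  "gain \<gamma> K = - (matrix_inv (K + \<gamma> *\<^sub>R mat 1) ** K)"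

definition finite_horizon_riccati ::
    "'a measure \<Rightarrow> (nat \<Rightarrow> 'a \<Rightarrow> real ^ 'd) \<Rightarrow> real \<Rightarrow> nat \<Rightarrow> (nat \<Rightarrow> real ^ 'd ^ 'd) \<Rightarrow> bool" where
  "finite_horizon_riccati M x \<gamma> N K \<longleftrightarrow>
     K N = second_moment M (x N) \<and>
     (\<forall>k<N. K k = riccati_step \<gamma> (second_moment M (x k)) (K (Suc k)))"

definition stationary_riccati :: "real \<Rightarrow> real ^ 'd ^ 'd \<Rightarrow> real ^ 'd ^ 'd \<Rightarrow> bool" where
  "stationary_riccati \<gamma> Q K \<longleftrightarrow> psd_matrix K \<and> K = riccati_step \<gamma> Q K"

end

theory Submission
  imports Defs
begin

text \<open>The update rule gives the error recursion \<open>e\<^sub>k\<^sub>+\<^sub>1 = (I + L\<^sub>k) e\<^sub>k - L\<^sub>k e\<^sub>k\<^sup>\<dagger>\<close> almost surely, where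
  \<open>e\<^sub>k\<^sup>\<dagger>\<close> is the error of the conditional mean. Errors have mean zero, so (i) and (ii) are the
  identity \<open>Tr Cov X = E |X|\<^sup>2\<close> and Minkowski's inequality in \<open>L\<^sup>2\<close>. For (iii), the stationary
  \<open>I + L = \<gamma> (K + \<gamma> I)\<inverse>\<close> is a strict contraction because \<open>Qbar\<close> is positive definite, and
  \<open>e\<^sub>k\<^sup>\<dagger>\<close> tends to zero in \<open>L\<^sup>2\<close> because the conditional mean is, up to a constant, at least as good
  as the moment estimator \<open>Qbar\<inverse> (1/n) \<Sum> y\<^sub>j x\<^sub>j\<close>. The latter has error \<open>O(1/n)\<close> since the
  residuals \<open>y\<^sub>j x\<^sub>j - Qbar w\<close> are pairwise orthogonal in \<open>L\<^sup>2\<close>.\<close>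

section \<open>Square-integrable random vectors\<close>

definition sq_integrable :: "'a measure \<Rightarrow> ('a \<Rightarrow> real ^ 'n) \<Rightarrow> bool" where
  "sq_integrable M X \<longleftrightarrow> X \<in> borel_measurable M \<and> integrable M (\<lambda>\<omega>. (norm (X \<omega>))\<^sup>2)"

text \<open>The squared L2 norm. The Bochner integral of a non-integrable function is 0, so upper
  bounds on this value carry \<open>sq_integrable\<close> along to keep it meaningful.\<close>

definition mean_square :: "'a measure \<Rightarrow> ('a \<Rightarrow> real ^ 'n) \<Rightarrow> real" where
  "mean_square M X = (LINT \<omega>|M. (norm (X \<omega>))\<^sup>2)"

lemma norm_sq_sum_components: "(norm (v :: real ^ 'n))\<^sup>2 = (\<Sum>i\<in>UNIV. (v $ i)\<^sup>2)"
  by (simp add: norm_vec_def L2_set_def sum_nonneg)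

lemma measurable_vec_nth [measurable (raw)]:
  assumes "X \<in> borel_measurable M"
  shows "(\<lambda>\<omega>. (X \<omega> :: real ^ 'n) $ i) \<in> borel_measurable M"
  using measurable_compose[OF assms, of "\<lambda>v. v $ i" borel]
  by (simp add: borel_measurable_continuous_onI continuous_on_component)

lemma measurable_vec_lambda:
  assumes "\<And>i. (\<lambda>\<omega>. f \<omega> i) \<in> borel_measurable M"
  shows "(\<lambda>\<omega>. (\<chi> i. f \<omega> i) :: real ^ 'n) \<in> borel_measurable M"
proof -
  have "(\<lambda>\<omega>. (\<chi> i. f \<omega> i) :: real ^ 'n) = (\<lambda>\<omega>. \<Sum>i\<in>UNIV. f \<omega> i *\<^sub>R axis i 1)"
    by (auto simp: vec_eq_iff axis_def if_distrib cong: if_cong)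
  then show ?thesis
    using assms by simp
qed

lemma measurable_matrix_vector_mult [measurable (raw)]:
  assumes "X \<in> borel_measurable M"
  shows "(\<lambda>\<omega>. (A :: real ^ 'n ^ 'm) *v X \<omega>) \<in> borel_measurable M"
  by (rule borel_measurable_continuous_on[OF _ assms]) (auto intro: linear_continuous_on)

lemma sq_integrable_measurable [dest]: "sq_integrable M X \<Longrightarrow> X \<in> borel_measurable M"
  by (simp add: sq_integrable_def)

text \<open>Domination by \<open>c^2 |X|^2\<close>. The almost-everywhere form of the bound lets
  square integrability pass between versions of a conditional expectation.\<close>

lemma sq_integrable_norm_bound:
  assumes "sq_integrable M X" "Y \<in> borel_measurable M" "AE \<omega> in M. norm (Y \<omega>) \<le> c * norm (X \<omega>)"
  shows "sq_integrable M Y"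
  unfolding sq_integrable_def
proof (intro conjI assms)
  show "integrable M (\<lambda>\<omega>. (norm (Y \<omega>))\<^sup>2)"
  proof (rule Bochner_Integration.integrable_bound)
    show "integrable M (\<lambda>\<omega>. c\<^sup>2 * (norm (X \<omega>))\<^sup>2)"
      using assms(1) by (simp add: sq_integrable_def)
    show "(\<lambda>\<omega>. (norm (Y \<omega>))\<^sup>2) \<in> borel_measurable M"
      using assms(2) by simp
    show "AE \<omega> in M. norm ((norm (Y \<omega>))\<^sup>2) \<le> norm (c\<^sup>2 * (norm (X \<omega>))\<^sup>2)"
      using assms(3)
    proof eventually_elim
      case (elim \<omega>)
      then show ?case
        using power_mono[OF elim norm_ge_zero, of 2] by (simp add: power_mult_distrib)
    qed
  qed
qed

lemma norm_sq_add_le: "(norm (a + b))\<^sup>2 \<le> 2 * (norm a)\<^sup>2 + 2 * (norm (b :: 'a :: real_inner))\<^sup>2"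
proof -
  have "0 \<le> (norm (a - b))\<^sup>2"
    by simp
  then show ?thesis
    by (simp add: power2_norm_eq_inner inner_add_left inner_add_right inner_diff_left inner_diff_right
        inner_commute)
qed

lemma sq_integrable_add:
  assumes "sq_integrable M X" "sq_integrable M Y"
  shows "sq_integrable M (\<lambda>\<omega>. X \<omega> + Y \<omega>)"
  unfolding sq_integrable_def
proof
  show meas: "(\<lambda>\<omega>. X \<omega> + Y \<omega>) \<in> borel_measurable M"
    using assms by (auto simp: sq_integrable_def)
  show "integrable M (\<lambda>\<omega>. (norm (X \<omega> + Y \<omega>))\<^sup>2)"
    by (rule Bochner_Integration.integrable_bound
        [of _ "\<lambda>\<omega>. 2 * (norm (X \<omega>))\<^sup>2 + 2 * (norm (Y \<omega>))\<^sup>2"])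
      (use assms meas norm_sq_add_le in \<open>auto simp: sq_integrable_def\<close>)
qed

lemma sq_integrable_matrix_mult:
  assumes "sq_integrable M X"
  shows "sq_integrable M (\<lambda>\<omega>. A *v X \<omega>)"
proof (rule sq_integrable_norm_bound[OF assms])
  show "(\<lambda>\<omega>. A *v X \<omega>) \<in> borel_measurable M"
    using assms by auto
  show "AE \<omega> in M. norm (A *v X \<omega>) \<le> onorm ((*v) A) * norm (X \<omega>)"
    by (simp add: onorm)
qed

lemma sq_integrable_uminus: "sq_integrable M X \<Longrightarrow> sq_integrable M (\<lambda>\<omega>. - X \<omega>)"
  by (auto simp: sq_integrable_def)

lemma sq_integrable_diff:
  assumes "sq_integrable M X" "sq_integrable M Y"
  shows "sq_integrable M (\<lambda>\<omega>. X \<omega> - Y \<omega>)"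
  using sq_integrable_add[OF assms(1) sq_integrable_uminus[OF assms(2)]] by simp

lemma sq_integrable_scaleR: "sq_integrable M X \<Longrightarrow> sq_integrable M (\<lambda>\<omega>. c *\<^sub>R X \<omega>)"
  by (auto simp: sq_integrable_def power_mult_distrib)

lemma sq_integrable_cong_AE:
  assumes "sq_integrable M X" "Y \<in> borel_measurable M" "AE \<omega> in M. Y \<omega> = X \<omega>"
  shows "sq_integrable M Y"
  by (rule sq_integrable_norm_bound[OF assms(1,2), of 1]) (use assms(3) in auto)

lemma sq_integrable_component:
  assumes "sq_integrable M X"
  shows "integrable M (\<lambda>\<omega>. (X \<omega> $ i)\<^sup>2)"
  by (rule Bochner_Integration.integrable_bound[of _ "\<lambda>\<omega>. (norm (X \<omega>))\<^sup>2"])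
    (use assms component_le_norm_cart[THEN power_mono, of _ i 2] in \<open>auto simp: sq_integrable_def\<close>)

text \<open>Conditional expectations of vectors are taken coordinatewise, so square integrability
  has to pass between a vector and its coordinates.\<close>

lemma sq_integrable_iff_components:
  "sq_integrable M X \<longleftrightarrow>
    (\<forall>i. (\<lambda>\<omega>. X \<omega> $ i) \<in> borel_measurable M \<and> integrable M (\<lambda>\<omega>. (X \<omega> $ i)\<^sup>2))"
proof
  assume *: "\<forall>i. (\<lambda>\<omega>. X \<omega> $ i) \<in> borel_measurable M \<and> integrable M (\<lambda>\<omega>. (X \<omega> $ i)\<^sup>2)"
  show "sq_integrable M X"
    unfolding sq_integrable_def norm_sq_sum_components
    using measurable_vec_lambda[of "\<lambda>\<omega> i. X \<omega> $ i" M] * by simp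
qed (auto intro: sq_integrable_component)

lemma mean_square_components:
  assumes "sq_integrable M X"
  shows "mean_square M X = (\<Sum>i\<in>UNIV. LINT \<omega>|M. (X \<omega> $ i)\<^sup>2)"
  unfolding mean_square_def norm_sq_sum_components
  using assms by (intro Bochner_Integration.integral_sum) (auto intro: sq_integrable_component)

section \<open>Mean-square estimates and Minkowski's inequality\<close>

lemma mean_square_nonneg: "0 \<le> mean_square M X"
  by (simp add: mean_square_def)

lemma mean_square_mono:
  assumes "sq_integrable M X" "sq_integrable M Y" "0 \<le> c"
    and "\<And>\<omega>. norm (Y \<omega>) \<le> c * norm (X \<omega>)"
  shows "mean_square M Y \<le> c\<^sup>2 * mean_square M X"
proof -
  have "mean_square M Y \<le> (LINT \<omega>|M. c\<^sup>2 * (norm (X \<omega>))\<^sup>2)"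
    unfolding mean_square_def
    using assms power_mono[OF assms(4) norm_ge_zero, of _ 2]
    by (intro integral_mono) (auto simp: sq_integrable_def power_mult_distrib)
  then show ?thesis
    by (simp add: mean_square_def)
qed

lemma mean_square_add_le:
  assumes "sq_integrable M X" "sq_integrable M Y"
  shows "mean_square M (\<lambda>\<omega>. X \<omega> + Y \<omega>) \<le> 2 * mean_square M X + 2 * mean_square M Y"
proof -
  have "mean_square M (\<lambda>\<omega>. X \<omega> + Y \<omega>) \<le> (LINT \<omega>|M. 2 * (norm (X \<omega>))\<^sup>2 + 2 * (norm (Y \<omega>))\<^sup>2)"
    unfolding mean_square_def
    using assms sq_integrable_add[OF assms] norm_sq_add_le
    by (intro integral_mono) (auto simp: sq_integrable_def)
  then show ?thesis
    using assms by (simp add: mean_square_def sq_integrable_def)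
qed

text \<open>The quadratic \<open>t -> E |X + t Y|^2\<close> is nonnegative, which yields
  Cauchy-Schwarz for the mixed moment; its value at \<open>t = 1\<close> then gives the claim. The
  squared form is the shape of the bound in (ii).\<close>

lemma mean_square_Minkowski:
  assumes X: "sq_integrable M X" and Y: "sq_integrable M Y"
  shows "mean_square M (\<lambda>\<omega>. X \<omega> + Y \<omega>) \<le>
    mean_square M X + mean_square M Y + 2 * sqrt (mean_square M X * mean_square M Y)"
proof -
  let ?a = "mean_square M X" and ?b = "mean_square M Y" and ?c = "LINT \<omega>|M. X \<omega> \<bullet> Y \<omega>"
  have int2: "integrable M (\<lambda>\<omega>. (norm (X \<omega>))\<^sup>2)" "integrable M (\<lambda>\<omega>. (norm (Y \<omega>))\<^sup>2)"
    "integrable M (\<lambda>\<omega>. (norm (X \<omega> + Y \<omega>))\<^sup>2)"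
    using X Y sq_integrable_add[OF X Y] by (auto simp: sq_integrable_def)
  have inner_eq: "X \<omega> \<bullet> Y \<omega> = ((norm (X \<omega> + Y \<omega>))\<^sup>2 - (norm (X \<omega>))\<^sup>2 - (norm (Y \<omega>))\<^sup>2) / 2" for \<omega>
    by (simp add: power2_norm_eq_inner inner_add_left inner_add_right inner_commute)
  have int_inner: "integrable M (\<lambda>\<omega>. X \<omega> \<bullet> Y \<omega>)"
    unfolding inner_eq using int2 by auto
  have expand: "mean_square M (\<lambda>\<omega>. X \<omega> + t *\<^sub>R Y \<omega>) = ?a + 2 * t * ?c + t\<^sup>2 * ?b" for t
  proof -
    have "(norm (X \<omega> + t *\<^sub>R Y \<omega>))\<^sup>2 =
        (norm (X \<omega>))\<^sup>2 + 2 * t * (X \<omega> \<bullet> Y \<omega>) + t\<^sup>2 * (norm (Y \<omega>))\<^sup>2" for \<omega>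
      by (simp only: power2_norm_eq_inner)
        (simp add: inner_add_left inner_add_right inner_commute power2_eq_square algebra_simps)
    then show ?thesis
      using int2 int_inner by (simp add: mean_square_def)
  qed
  have nonneg: "0 \<le> ?a + 2 * t * ?c + t\<^sup>2 * ?b" for t
    using expand[of t] mean_square_nonneg[of M "\<lambda>\<omega>. X \<omega> + t *\<^sub>R Y \<omega>"] by simp
  have "?c\<^sup>2 \<le> ?a * ?b"
  proof (cases "?b = 0")
    case True
    have "?c = 0"
    proof (rule ccontr)
      assume "?c \<noteq> 0"
      \<comment> \<open>With \<open>?b = 0\<close> the quadratic is affine in \<open>t\<close>, and
        this choice of \<open>t\<close> gives it the value -1.\<close>
      then show False
        using nonneg[of "- (?a + 1) / (2 * ?c)"] True by (simp add: field_simps)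
    qed
    then show ?thesis
      using True by simp
  next
    case False
    then have "0 < ?b"
      using mean_square_nonneg[of M Y] by simp
    \<comment> \<open>The quadratic is evaluated at its minimiser \<open>- ?c / ?b\<close>; the
      factor \<open>?b\<close> clears the denominator.\<close>
    then have "0 \<le> (?a + 2 * (- ?c / ?b) * ?c + (- ?c / ?b)\<^sup>2 * ?b) * ?b"
      using nonneg[of "- ?c / ?b"] by (intro mult_nonneg_nonneg) auto
    also have "\<dots> = ?a * ?b - ?c\<^sup>2"
      using \<open>0 < ?b\<close> by (simp add: field_simps power2_eq_square)
    finally show ?thesis
      by simp
  qed
  then have "?c \<le> sqrt (?a * ?b)"
    by (rule real_le_rsqrt)
  then show ?thesis
    using expand[of 1] by simp
qed

text \<open>The right side of Minkowski's inequality is a perfect square. In root form the error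
  recursion becomes linear and can be iterated for (iii).\<close>

lemma sqrt_mean_square_add_le:
  assumes "sq_integrable M X" "sq_integrable M Y"
  shows "sqrt (mean_square M (\<lambda>\<omega>. X \<omega> + Y \<omega>)) \<le> sqrt (mean_square M X) + sqrt (mean_square M Y)"
  using mean_square_Minkowski[OF assms]
  by (intro real_le_lsqrt)
    (auto simp: mean_square_nonneg power2_sum real_sqrt_mult)

section \<open>Second moments on a probability space and traces of covariances\<close>

context prob_space
begin

text \<open>\<open>|a| <= 1 + a^2\<close>, and the constant 1 is integrable because the total mass
  is finite.\<close>

lemma integrable_of_sq:
  fixes f :: "'a \<Rightarrow> real"
  assumes "f \<in> borel_measurable M" "integrable M (\<lambda>\<omega>. (f \<omega>)\<^sup>2)"
  shows "integrable M f"
proof (rule Bochner_Integration.integrable_bound)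
  show "integrable M (\<lambda>\<omega>. 1 + (f \<omega>)\<^sup>2)"
    using assms by simp
  have "\<bar>a\<bar> \<le> 1 + a\<^sup>2" for a :: real
    using sum_squares_bound[of "\<bar>a\<bar>" 1] abs_ge_zero[of a] by simp
  then show "AE \<omega> in M. norm (f \<omega>) \<le> norm (1 + (f \<omega>)\<^sup>2)"
    by (auto intro!: AE_I2)
qed (fact assms)

lemma integrable_mult_of_sq:
  fixes f g :: "'a \<Rightarrow> real"
  assumes [measurable]: "f \<in> borel_measurable M" "g \<in> borel_measurable M"
    and "integrable M (\<lambda>\<omega>. (f \<omega>)\<^sup>2)" "integrable M (\<lambda>\<omega>. (g \<omega>)\<^sup>2)"
  shows "integrable M (\<lambda>\<omega>. f \<omega> * g \<omega>)"
proof (rule Bochner_Integration.integrable_bound)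
  show "integrable M (\<lambda>\<omega>. (f \<omega>)\<^sup>2 + (g \<omega>)\<^sup>2)"
    using assms by simp
  have "\<bar>a * b\<bar> \<le> a\<^sup>2 + b\<^sup>2" for a b :: real
    using sum_squares_bound[of "\<bar>a\<bar>" "\<bar>b\<bar>"] abs_ge_zero[of "a * b"]
    unfolding abs_mult power2_abs by linarith
  then show "AE \<omega> in M. norm (f \<omega> * g \<omega>) \<le> norm ((f \<omega>)\<^sup>2 + (g \<omega>)\<^sup>2)"
    by (auto intro!: AE_I2)
qed simp

lemma sq_integrable_integrable:
  assumes "sq_integrable M X"
  shows "integrable M X"
  by (rule Bochner_Integration.integrable_bound[of _ "\<lambda>\<omega>. norm (X \<omega>)"])
    (use assms in \<open>auto simp: sq_integrable_def intro!: integrable_of_sq\<close>)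

text \<open>The entries lie in a general Euclidean space so that the rule applies twice to a random
  matrix, first to its rows and then to their entries.\<close>

lemma integrable_vecI:
  fixes f :: "'a \<Rightarrow> 'b :: euclidean_space ^ 'n"
  assumes "\<And>i. integrable M (\<lambda>\<omega>. f \<omega> $ i)"
  shows "integrable M f"
proof -
  have "linear (axis i :: 'b \<Rightarrow> 'b ^ 'n)" for i
    by (auto intro!: linearI simp: vec_eq_iff axis_def)
  then have "bounded_linear (axis i :: 'b \<Rightarrow> 'b ^ 'n)" for i
    by (simp add: linear_conv_bounded_linear)
  then have "integrable M (\<lambda>\<omega>. axis i (f \<omega> $ i) :: 'b ^ 'n)" for i
    using assms by (rule integrable_bounded_linear)
  then have "integrable M (\<lambda>\<omega>. \<Sum>i\<in>UNIV. axis i (f \<omega> $ i) :: 'b ^ 'n)"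
    by simp
  moreover have "(\<Sum>i\<in>UNIV. axis i (v $ i)) = v" for v :: "'b ^ 'n"
    by (simp add: vec_eq_iff axis_def)
  ultimately show ?thesis
    by simp
qed

lemma integrable_outer:
  assumes "sq_integrable M X"
  shows "integrable M (\<lambda>\<omega>. outer (X \<omega>) (X \<omega>))"
proof (intro integrable_vecI)
  fix i j
  have "integrable M (\<lambda>\<omega>. X \<omega> $ i * X \<omega> $ j)"
    using assms by (intro integrable_mult_of_sq sq_integrable_component) auto
  then show "integrable M (\<lambda>\<omega>. outer (X \<omega>) (X \<omega>) $ i $ j)"
    by (simp add: outer_def)
qed

lemma trace_matrix_outer:
  "trace (A ** outer v v ** transpose A) = (norm (A *v v))\<^sup>2" for A :: "real ^ 'n ^ 'm"
proof -
  have "A ** outer v v ** transpose A = outer (A *v v) (A *v v)"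
    by (simp add: vec_eq_iff matrix_matrix_mult_def matrix_vector_mult_def outer_def transpose_def
        sum_distrib_left sum_distrib_right mult.assoc mult.commute mult.left_commute)
  then show ?thesis
    by (simp add: norm_sq_sum_components trace_def outer_def power2_eq_square[symmetric])
qed

text \<open>\<open>C -> Tr (A C A')\<close> is linear on a finite-dimensional space, hence bounded,
  and commutes with the integral; on \<open>outer v v\<close> it equals \<open>|A v|^2\<close>. Mean
  zero removes the centring in the covariance.\<close>

lemma trace_matrix_covariance:
  fixes A :: "real ^ 'n ^ 'm"
  assumes "sq_integrable M X" "expectation X = 0"
  shows "trace (A ** covariance M X ** transpose A) = mean_square M (\<lambda>\<omega>. A *v X \<omega>)"
proof -
  have "linear (\<lambda>C. trace (A ** C ** transpose A))"
    by (rule linearI)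
      (simp_all add: trace_def matrix_matrix_mult_def sum.distrib sum_distrib_left sum_distrib_right
        distrib_left distrib_right mult.assoc mult.left_commute)
  then have "bounded_linear (\<lambda>C. trace (A ** C ** transpose A))"
    by (simp add: linear_conv_bounded_linear)
  from integral_bounded_linear[OF this integrable_outer[OF assms(1)]]
  show ?thesis
    using assms(2) by (simp add: covariance_def mean_square_def trace_matrix_outer)
qed

lemma trace_covariance:
  assumes "sq_integrable M X" "expectation X = 0"
  shows "trace (covariance M X) = mean_square M X"
  using trace_matrix_covariance[OF assms, of "mat 1"] by (simp add: transpose_mat)

end

subsection \<open>Conditional expectation\<close>

context finite_measure_subalgebra
begin

text \<open>Jensen's inequality for the square, then integration: conditional expectation is a
  contraction in L2.\<close>

lemma real_cond_exp_sq:
  assumes "f \<in> borel_measurable M" "integrable M (\<lambda>\<omega>. (f \<omega>)\<^sup>2)" "integrable M f"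
  shows "integrable M (\<lambda>\<omega>. (real_cond_exp M F f \<omega>)\<^sup>2)"
    and "(LINT \<omega>|M. (real_cond_exp M F f \<omega>)\<^sup>2) \<le> (LINT \<omega>|M. (f \<omega>)\<^sup>2)"
proof -
  have convex: "convex_on UNIV (\<lambda>t :: real. t\<^sup>2)"
    by (rule convex_power2)
  have AE: "AE \<omega> in M. (real_cond_exp M F f \<omega>)\<^sup>2 \<le> real_cond_exp M F (\<lambda>\<omega>. (f \<omega>)\<^sup>2) \<omega>"
    by (rule real_cond_exp_jensens_inequality(2)[OF assms(3), of UNIV])
      (use assms convex in auto)
  show int: "integrable M (\<lambda>\<omega>. (real_cond_exp M F f \<omega>)\<^sup>2)"
    by (rule Bochner_Integration.integrable_bound[OF real_cond_exp_int(1)[OF assms(2)]])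
      (use AE in auto)
  have "(LINT \<omega>|M. (real_cond_exp M F f \<omega>)\<^sup>2) \<le> (LINT \<omega>|M. real_cond_exp M F (\<lambda>\<omega>. (f \<omega>)\<^sup>2) \<omega>)"
    by (rule integral_mono_AE[OF int real_cond_exp_int(1)[OF assms(2)] AE])
  then show "(LINT \<omega>|M. (real_cond_exp M F f \<omega>)\<^sup>2) \<le> (LINT \<omega>|M. (f \<omega>)\<^sup>2)"
    by (simp add: real_cond_exp_int(2)[OF assms(2)])
qed

end

lemma (in prob_space) vec_cond_exp_L2:
  assumes "subalgebra M F" "sq_integrable M X"
  shows "sq_integrable M (vec_cond_exp M F X)"
    and "mean_square M (vec_cond_exp M F X) \<le> mean_square M X"
    and "expectation (vec_cond_exp M F X) = expectation X"
proof -
  interpret F: finite_measure_subalgebra M F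
    by unfold_locales (fact assms)
  have comp: "(\<lambda>\<omega>. X \<omega> $ i) \<in> borel_measurable M" "integrable M (\<lambda>\<omega>. (X \<omega> $ i)\<^sup>2)"
    "integrable M (\<lambda>\<omega>. X \<omega> $ i)" for i
    using assms(2) integrable_of_sq[of "\<lambda>\<omega>. X \<omega> $ i"] by (auto simp: sq_integrable_iff_components)
  show sq: "sq_integrable M (vec_cond_exp M F X)"
    using F.real_cond_exp_sq(1)[OF comp] by (simp add: sq_integrable_iff_components vec_cond_exp_def)
  show "mean_square M (vec_cond_exp M F X) \<le> mean_square M X"
    unfolding mean_square_components[OF sq] mean_square_components[OF assms(2)]
    using F.real_cond_exp_sq(2)[OF comp] by (intro sum_mono) (simp add: vec_cond_exp_def)
  have nth: "expectation Y $ i = expectation (\<lambda>\<omega>. Y \<omega> $ i)" if "sq_integrable M Y"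
    for Y :: "'a \<Rightarrow> real ^ 'b" and i
    using integral_bounded_linear[OF bounded_linear_vec_nth sq_integrable_integrable[OF that], of i]
    by simp
  show "expectation (vec_cond_exp M F X) = expectation X"
    by (simp add: vec_eq_iff nth[OF sq] nth[OF assms(2)])
      (simp add: vec_cond_exp_def F.real_cond_exp_int(2)[OF comp(3)])
qed

text \<open>Linearity, plus the fact that an \<open>F\<close>-measurable function is its own
  conditional expectation. The exceptional null sets of the finitely many coordinates are merged
  into one.\<close>

lemma (in prob_space) vec_cond_exp_diff_measurable:
  assumes "subalgebra M F" "sq_integrable M X" "sq_integrable M Y" "Y \<in> borel_measurable F"
  shows "AE \<omega> in M. vec_cond_exp M F (\<lambda>\<omega>. Y \<omega> - X \<omega>) \<omega> = Y \<omega> - vec_cond_exp M F X \<omega>"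
proof -
  interpret F: finite_measure_subalgebra M F
    by unfold_locales (fact assms)
  have int: "integrable M (\<lambda>\<omega>. X \<omega> $ i)" "integrable M (\<lambda>\<omega>. Y \<omega> $ i)" for i
    using assms(2,3) integrable_of_sq[of "\<lambda>\<omega>. X \<omega> $ i"] integrable_of_sq[of "\<lambda>\<omega>. Y \<omega> $ i"]
    by (auto simp: sq_integrable_iff_components)
  have meas: "(\<lambda>\<omega>. Y \<omega> $ i) \<in> borel_measurable F" for i
    using assms(4) by simp
  have "AE \<omega> in M. real_cond_exp M F (\<lambda>\<omega>. Y \<omega> $ i - X \<omega> $ i) \<omega> =
      Y \<omega> $ i - real_cond_exp M F (\<lambda>\<omega>. X \<omega> $ i) \<omega>" for i
    using F.real_cond_exp_diff[OF int(2)[of i] int(1)[of i]]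
      F.real_cond_exp_F_meas[OF int(2)[of i] meas[of i]]
    by eventually_elim simp
  then have "AE \<omega> in M. \<forall>i\<in>UNIV. real_cond_exp M F (\<lambda>\<omega>. Y \<omega> $ i - X \<omega> $ i) \<omega> =
      Y \<omega> $ i - real_cond_exp M F (\<lambda>\<omega>. X \<omega> $ i) \<omega>"
    by (intro AE_finite_allI) auto
  then show ?thesis
    by eventually_elim (simp add: vec_cond_exp_def vec_eq_iff)
qed

text \<open>The factor 4, in place of the optimal 1, spares the orthogonality of the projection.\<close>

lemma (in prob_space) mean_square_cond_exp_error_le:
  assumes F: "subalgebra M F" and X: "sq_integrable M X" and Y: "sq_integrable M Y"
    and meas: "Y \<in> borel_measurable F"
  shows "mean_square M (\<lambda>\<omega>. vec_cond_exp M F X \<omega> - X \<omega>) \<le> 4 * mean_square M (\<lambda>\<omega>. Y \<omega> - X \<omega>)"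
proof -
  let ?C = "vec_cond_exp M F (\<lambda>\<omega>. Y \<omega> - X \<omega>)"
  note YX = sq_integrable_diff[OF Y X]
  note C = vec_cond_exp_L2[OF F YX]
  have [measurable]: "X \<in> borel_measurable M" "Y \<in> borel_measurable M" "?C \<in> borel_measurable M"
    "vec_cond_exp M F X \<in> borel_measurable M"
    using X Y C(1) vec_cond_exp_L2(1)[OF F X] by auto
  \<comment> \<open>The error of the conditional mean is \<open>Y - X\<close> minus its own
    conditional expectation, and the latter is no larger in mean square.\<close>
  have "mean_square M (\<lambda>\<omega>. vec_cond_exp M F X \<omega> - X \<omega>) =
      mean_square M (\<lambda>\<omega>. (Y \<omega> - X \<omega>) + - ?C \<omega>)"
    unfolding mean_square_def
  proof (rule integral_cong_AE)
    show "AE \<omega> in M. (norm (vec_cond_exp M F X \<omega> - X \<omega>))\<^sup>2 = (norm ((Y \<omega> - X \<omega>) + - ?C \<omega>))\<^sup>2"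
      using vec_cond_exp_diff_measurable[OF F X Y meas] by eventually_elim simp
  qed auto
  also have "\<dots> \<le> 2 * mean_square M (\<lambda>\<omega>. Y \<omega> - X \<omega>) + 2 * mean_square M ?C"
    using mean_square_add_le[OF YX sq_integrable_uminus[OF C(1)]] by (simp add: mean_square_def)
  also have "\<dots> \<le> 4 * mean_square M (\<lambda>\<omega>. Y \<omega> - X \<omega>)"
    using C(2) by simp
  finally show ?thesis .
qed

text \<open>The complement of the support is covered by open null sets. A countable basis reduces
  this cover to countably many of them, so the complement is null.\<close>

lemma AE_distribution_support:
  fixes D :: "'b :: second_countable_topology measure"
  assumes "sets D = sets borel"
  shows "AE z in D. z \<in> distribution_support D"
proof -
  obtain \<B> :: "'b set set" where \<B>: "countable \<B>" "topological_basis \<B>"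
    using ex_countable_basis by blast
  let ?N = "\<Union>{U \<in> \<B>. emeasure D U = 0}"
  have "?N \<in> null_sets D"
    using \<B> topological_basis_open[OF \<B>(2)] assms
    by (intro null_sets_UN'[where N = "\<lambda>U. U" , simplified]) (auto intro!: null_setsI)
  moreover have "- distribution_support D \<subseteq> ?N"
  proof
    fix z assume "z \<in> - distribution_support D"
    then obtain U where U: "open U" "z \<in> U" "emeasure D U = 0"
      by (auto simp: distribution_support_def zero_less_iff_neq_zero)
    then obtain V where V: "V \<in> \<B>" "z \<in> V" "V \<subseteq> U"
      using topological_basisE[OF \<B>(2)] by metis
    have "emeasure D V \<le> emeasure D U"
      using U V assms by (intro emeasure_mono) auto
    then show "z \<in> ?N"
      using U V by auto
  qed
  ultimately show ?thesis
    by (intro AE_I') auto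
qed

text \<open>A Borel function of \<open>Y\<close> generates a smaller sigma-algebra; this carries
  independence from the sources to functions of them.\<close>

lemma preimage_events_compose:
  fixes F :: "'c :: topological_space \<Rightarrow> real"
  assumes F: "F \<in> borel_measurable borel"
  shows "{(\<lambda>\<omega>. F (Y \<omega>)) -` A \<inter> space M |A. A \<in> sets borel} \<subseteq>
      {Y -` A \<inter> space M |A. A \<in> sets borel}"
proof clarify
  fix A :: "real set" assume "A \<in> sets borel"
  then have "F -` A \<in> sets borel"
    using measurable_sets_borel[OF F] by blast
  moreover have "(\<lambda>\<omega>. F (Y \<omega>)) -` A \<inter> space M = Y -` (F -` A) \<inter> space M"
    by blast
  ultimately show "\<exists>A'. (\<lambda>\<omega>. F (Y \<omega>)) -` A \<inter> space M = Y -` A' \<inter> space M \<and> A' \<in> sets borel"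
    by blast
qed

section \<open>Orthogonal sums and second moments of Gaussian variables\<close>

context prob_space
begin

text \<open>Pythagoras, by induction on \<open>n\<close>. The growth is linear in \<open>n\<close>
  rather than quadratic, so averages of orthogonal terms vanish at rate \<open>1/n\<close>.\<close>

lemma mean_square_sum_orthogonal:
  assumes sq: "\<And>j. sq_integrable M (D j)"
    and orth: "\<And>i j. i \<noteq> j \<Longrightarrow> (LINT \<omega>|M. D i \<omega> \<bullet> D j \<omega>) = 0"
    and bound: "\<And>j. mean_square M (D j) \<le> C"
  shows "mean_square M (\<lambda>\<omega>. \<Sum>j<n. D j \<omega>) \<le> real n * C"
    and "sq_integrable M (\<lambda>\<omega>. \<Sum>j<n. D j \<omega>)"
proof -
  have int: "integrable M (\<lambda>\<omega>. D i \<omega> \<bullet> D j \<omega>)" for i j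
    unfolding inner_vec_def inner_real_def using sq
    by (intro Bochner_Integration.integrable_sum integrable_mult_of_sq sq_integrable_component
        measurable_vec_nth sq_integrable_measurable)
  have "mean_square M (\<lambda>\<omega>. \<Sum>j<n. D j \<omega>) \<le> real n * C \<and> sq_integrable M (\<lambda>\<omega>. \<Sum>j<n. D j \<omega>)"
  proof (induction n)
    case 0
    show ?case
      by (simp add: mean_square_def sq_integrable_def)
  next
    case (Suc n)
    let ?S = "\<lambda>\<omega>. \<Sum>j<n. D j \<omega>"
    have cross: "integrable M (\<lambda>\<omega>. ?S \<omega> \<bullet> D n \<omega>)" "(LINT \<omega>|M. ?S \<omega> \<bullet> D n \<omega>) = 0"
      using int orth by (simp_all add: inner_sum_left)
    have S: "sq_integrable M ?S" "mean_square M ?S \<le> real n * C"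
      using Suc by auto
    have "(norm (a + b))\<^sup>2 = (norm a)\<^sup>2 + 2 * (a \<bullet> b) + (norm b)\<^sup>2" for a b :: "real ^ 'b"
      by (simp add: power2_norm_eq_inner inner_add_left inner_add_right inner_commute)
    then have "mean_square M (\<lambda>\<omega>. ?S \<omega> + D n \<omega>) = mean_square M ?S + mean_square M (D n)"
      using S(1) sq[of n] cross by (simp add: mean_square_def sq_integrable_def)
    also have "\<dots> \<le> real (Suc n) * C"
      using S(2) bound[of n] by (simp add: distrib_right)
    finally show ?case
      using sq_integrable_add[OF S(1) sq[of n]] by simp
  qed
  then show "mean_square M (\<lambda>\<omega>. \<Sum>j<n. D j \<omega>) \<le> real n * C"
    "sq_integrable M (\<lambda>\<omega>. \<Sum>j<n. D j \<omega>)"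
    by auto
qed

lemma integrable_normal_square:
  assumes D: "distributed M lborel X (normal_density \<mu> s)" and s: "0 < s"
  shows "integrable M (\<lambda>\<omega>. (X \<omega>)\<^sup>2)"
proof -
  \<comment> \<open>The square \<open>t^2\<close> is expanded around \<open>\<mu>\<close> into
    central moments of order 2, 1 and 0; the explicit powers 1 and 0 match the form of
    \<open>integrable_normal_moment\<close>.\<close>
  have "integrable lborel (\<lambda>t. normal_density \<mu> s t * (t - \<mu>)\<^sup>2 +
      2 * \<mu> * (normal_density \<mu> s t * (t - \<mu>) ^ 1) + \<mu>\<^sup>2 * (normal_density \<mu> s t * (t - \<mu>) ^ 0))"
    using s by (intro Bochner_Integration.integrable_add integrable_mult_right integrable_normal_moment)
  also have "(\<lambda>t. normal_density \<mu> s t * (t - \<mu>)\<^sup>2 + 2 * \<mu> * (normal_density \<mu> s t * (t - \<mu>) ^ 1) +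
      \<mu>\<^sup>2 * (normal_density \<mu> s t * (t - \<mu>) ^ 0)) = (\<lambda>t. normal_density \<mu> s t * t\<^sup>2)"
    by (simp add: fun_eq_iff power2_eq_square algebra_simps)
  finally show ?thesis
    using distributed_integrable[OF D, of "\<lambda>t. t\<^sup>2"] by simp
qed

lemma gaussian_vector_sq_integrable:
  assumes "gaussian_vector M X"
  shows "sq_integrable M X"
proof -
  have meas: "X \<in> borel_measurable M"
    using assms by (simp add: gaussian_vector_def)
  have "integrable M (\<lambda>\<omega>. (X \<omega> $ i)\<^sup>2)" for i
  proof -
    from assms consider c where "AE \<omega> in M. axis i 1 \<bullet> X \<omega> = c"
      | \<mu> s where "0 < s" "distributed M lborel (\<lambda>\<omega>. axis i 1 \<bullet> X \<omega>) (normal_density \<mu> s)"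
      unfolding gaussian_vector_def by blast
    then show ?thesis
    proof cases
      case 1
      have "integrable M (\<lambda>\<omega>. (X \<omega> $ i)\<^sup>2) \<longleftrightarrow> integrable M (\<lambda>\<omega>. c\<^sup>2)"
        using 1 meas by (intro integrable_cong_AE) (auto simp: inner_axis' elim: eventually_mono)
      then show ?thesis
        by simp
    next
      case 2
      then show ?thesis
        using integrable_normal_square by (auto simp: inner_axis')
    qed
  qed
  then show ?thesis
    using meas by (simp add: sq_integrable_iff_components)
qed

end

section \<open>The data model\<close>

context data_model
begin

lemma w_sq_integrable: "sq_integrable M w"
  by (rule gaussian_vector_sq_integrable[OF w_gaussian])

lemma w_measurable [measurable]: "w \<in> borel_measurable M"
  using w_sq_integrable by auto

lemma noise_measurable [measurable]: "\<epsilon> k \<in> borel_measurable M"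
  using distributed_measurable[OF noise_gaussian[of k]] by simp

declare x_measurable [measurable]

lemma noise_sq_integrable: "integrable M (\<lambda>\<omega>. (\<epsilon> k \<omega>)\<^sup>2)"
  by (rule integrable_normal_square[OF noise_gaussian \<sigma>_pos])

lemma noise_integrable: "integrable M (\<epsilon> k)"
  by (rule integrable_of_sq[OF _ noise_sq_integrable]) simp

lemma noise_mean: "expectation (\<epsilon> k) = 0"
  by (rule normal_distributed_expectation[OF \<sigma>_pos noise_gaussian])

lemma noise_second_moment: "expectation (\<lambda>\<omega>. (\<epsilon> k \<omega>)\<^sup>2) = \<sigma>\<^sup>2"
  using normal_distributed_variance[OF \<sigma>_pos noise_gaussian[of k]] by (simp add: noise_mean)

lemma model_output_measurable [measurable]: "model_output w x \<epsilon> k \<in> borel_measurable M"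
  unfolding model_output_def[abs_def] by measurable

text \<open>A distribution is concentrated on its support, which is bounded. Since all inputs share
  one distribution, a single \<open>B\<close> serves every \<open>k\<close>.\<close>

lemma input_bounded:
  obtains B where "0 < B" "\<And>k. AE \<omega> in M. norm (x k \<omega>) \<le> B"
proof -
  obtain B where B: "0 < B" "\<And>z. z \<in> distribution_support (distr M borel (x 0)) \<Longrightarrow> norm z \<le> B"
    using x_bounded bounded_pos by metis
  have "AE \<omega> in M. norm (x k \<omega>) \<le> B" for k
  proof -
    have "AE z in distr M borel (x k). z \<in> distribution_support (distr M borel (x k))"
      by (rule AE_distribution_support) simp
    then have "AE z in distr M borel (x k). norm z \<le> B"
      unfolding x_identical[of k] by eventually_elim (rule B)
    then show ?thesis
      by (subst (asm) AE_distr_iff) auto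
  qed
  with B(1) show thesis
    by (rule that)
qed

text \<open>Every term in the product of two residuals is a product of this form, with constant 1 in
  place of an absent factor. \<open>has_bochner_integral\<close> delivers integrability and value
  together, so that the terms can simply be added.\<close>

lemma has_integral_source_product:
  fixes f g h :: "real ^ 'd \<Rightarrow> real" and p q :: "real \<Rightarrow> real"
  assumes "i \<noteq> j"
    and [measurable]: "f \<in> borel_measurable borel" "g \<in> borel_measurable borel"
      "h \<in> borel_measurable borel" "p \<in> borel_measurable borel" "q \<in> borel_measurable borel"
    and int: "integrable M (\<lambda>\<omega>. f (w \<omega>))" "integrable M (\<lambda>\<omega>. g (x i \<omega>))"
      "integrable M (\<lambda>\<omega>. h (x j \<omega>))" "integrable M (\<lambda>\<omega>. p (\<epsilon> i \<omega>))" "integrable M (\<lambda>\<omega>. q (\<epsilon> j \<omega>))"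
  shows "has_bochner_integral M (\<lambda>\<omega>. f (w \<omega>) * g (x i \<omega>) * h (x j \<omega>) * p (\<epsilon> i \<omega>) * q (\<epsilon> j \<omega>))
    (expectation (\<lambda>\<omega>. f (w \<omega>)) * expectation (\<lambda>\<omega>. g (x i \<omega>)) * expectation (\<lambda>\<omega>. h (x j \<omega>)) *
      expectation (\<lambda>\<omega>. p (\<epsilon> i \<omega>)) * expectation (\<lambda>\<omega>. q (\<epsilon> j \<omega>)))"
proof -
  define I where "I = {Weight, Input i, Input j, Noise i, Noise j}"
  \<comment> \<open>The family is indexed by all sources but used only on \<open>I\<close>, where an
    index other than \<open>i\<close> has to be \<open>j\<close>.\<close>
  define X where "X s = (case s of Weight \<Rightarrow> \<lambda>\<omega>. f (w \<omega>)
    | Input k \<Rightarrow> \<lambda>\<omega>. (if k = i then g else h) (x k \<omega>)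
    | Noise k \<Rightarrow> \<lambda>\<omega>. (if k = i then p else q) (\<epsilon> k \<omega>))" for s
  have "indep_vars (\<lambda>_. borel) X I"
    unfolding indep_vars_def2
  proof
    show "\<forall>s\<in>I. random_variable borel (X s)"
      by (auto simp: I_def X_def)
    show "indep_sets (\<lambda>s. {X s -` A \<inter> space M |A. A \<in> sets borel}) I"
    proof (rule indep_sets_mono[OF independent])
      fix s show "{X s -` A \<inter> space M |A. A \<in> sets borel} \<subseteq> source_events M w x \<epsilon> s"
      proof (cases s)
        case Weight
        show ?thesis
          unfolding Weight X_def source.case source_events.simps by (rule preimage_events_compose) fact
      next
        case (Input k)
        have "(if k = i then g else h) \<in> borel_measurable borel"
          by simp
        then show ?thesis
          unfolding Input X_def source.case source_events.simps by (rule preimage_events_compose)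
      next
        case (Noise k)
        have "(if k = i then p else q) \<in> borel_measurable borel"
          by simp
        then show ?thesis
          unfolding Noise X_def source.case source_events.simps by (rule preimage_events_compose)
      qed
    qed simp
  qed
  moreover have "integrable M (X s)" if "s \<in> I" for s
    using that int \<open>i \<noteq> j\<close> by (auto simp: I_def X_def)
  moreover have "finite I"
    by (simp add: I_def)
  ultimately have "has_bochner_integral M (\<lambda>\<omega>. \<Prod>s\<in>I. X s \<omega>) (\<Prod>s\<in>I. expectation (X s))"
    unfolding has_bochner_integral_iff
    by (intro conjI indep_vars_integrable indep_vars_lebesgue_integral)
  moreover have "(\<Prod>s\<in>I. G s) = G Weight * G (Input i) * G (Input j) * G (Noise i) * G (Noise j)"
    for G :: "source \<Rightarrow> real"
    using \<open>i \<noteq> j\<close> by (simp add: I_def mult.assoc)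
  ultimately show ?thesis
    using \<open>i \<noteq> j\<close> by (simp add: X_def)
qed

end

text \<open>\<open>Q v = 0\<close> would make the quadratic form vanish at \<open>v\<close>, so the
  kernel is trivial. Applied both to \<open>Qbar\<close> and to
  \<open>K + \<gamma> I\<close>.\<close>

lemma pd_matrix_inverse:
  fixes Q :: "real ^ 'n ^ 'n"
  assumes "pd_matrix Q"
  shows "matrix_inv Q ** Q = mat 1" "Q ** matrix_inv Q = mat 1"
proof -
  have "\<forall>v. Q *v v = 0 \<longrightarrow> v = 0"
    using assms unfolding pd_matrix_def by (metis inner_zero_right less_irrefl)
  then have "invertible Q"
    by (simp add: matrix_left_invertible_ker invertible_left_inverse)
  then have "Q ** matrix_inv Q = mat 1 \<and> matrix_inv Q ** Q = mat 1"
    unfolding invertible_def matrix_inv_def by (rule someI_ex)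
  then show "matrix_inv Q ** Q = mat 1" "Q ** matrix_inv Q = mat 1"
    by auto
qed

lemma sum_add_product:
  fixes X Y :: "'a :: comm_semiring_0"
  shows "(sum f A + X) * (sum g B + Y) =
    (\<Sum>b\<in>A. \<Sum>c\<in>B. f b * g c) + (\<Sum>b\<in>A. f b * Y) + (\<Sum>c\<in>B. X * g c) + X * Y"
  unfolding sum_product[symmetric] sum_distrib_left[symmetric] sum_distrib_right[symmetric]
  by (simp add: algebra_simps)

context data_model
begin

subsection \<open>The moment estimator\<close>

text \<open>The deviation of \<open>y_j x_j\<close> from its conditional mean given
  \<open>w\<close>, which is \<open>Qbar w\<close>. It equals
  \<open>(Q_j - Qbar) w + \<epsilon>_j x_j\<close>.\<close>

definition residual :: "nat \<Rightarrow> 'a \<Rightarrow> real ^ 'd" where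
  "residual j \<omega> = model_output w x \<epsilon> j \<omega> *\<^sub>R x j \<omega> - Qbar *v w \<omega>"

text \<open>Bounded inputs give \<open>|residual j| <= c |w| + B |\<epsilon> j|\<close> almost
  surely. The resulting bound is uniform in \<open>j\<close> because the noises have a common
  variance.\<close>

lemma residual_bound:
  obtains C where "\<And>j. sq_integrable M (residual j)" "\<And>j. mean_square M (residual j) \<le> C"
proof -
  obtain B where B: "0 < B" "\<And>k. AE \<omega> in M. norm (x k \<omega>) \<le> B"
    by (rule input_bounded) blast
  \<comment> \<open>\<open>B^2\<close> bounds the coefficient of \<open>|w|\<close> coming from
    \<open>(w . x_j) x_j\<close>, and the operator norm bounds that from
    \<open>Qbar w\<close>.\<close>
  define c where "c = B\<^sup>2 + onorm ((*v) Qbar)"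
  have c: "0 \<le> c"
    by (simp add: c_def onorm_pos_le)
  let ?R = "\<lambda>j \<omega>. 2 * c\<^sup>2 * (norm (w \<omega>))\<^sup>2 + 2 * B\<^sup>2 * (\<epsilon> j \<omega>)\<^sup>2"
  have [measurable]: "residual j \<in> borel_measurable M" for j
    unfolding residual_def[abs_def] by measurable
  have int: "integrable M (?R j)" for j
    using w_sq_integrable noise_sq_integrable by (simp add: sq_integrable_def)
  have AE: "AE \<omega> in M. (norm (residual j \<omega>))\<^sup>2 \<le> ?R j \<omega>" for j
    using B(2)[of j]
  proof eventually_elim
    case (elim \<omega>)
    have "\<bar>w \<omega> \<bullet> x j \<omega>\<bar> * norm (x j \<omega>) \<le> (norm (w \<omega>) * B) * B"
      using elim B(1) Cauchy_Schwarz_ineq2[of "w \<omega>" "x j \<omega>"]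
      by (intro mult_mono order_trans[OF Cauchy_Schwarz_ineq2] mult_left_mono) auto
    moreover have "norm (Qbar *v w \<omega>) \<le> onorm ((*v) Qbar) * norm (w \<omega>)"
      by (simp add: onorm)
    moreover have "\<bar>\<epsilon> j \<omega>\<bar> * norm (x j \<omega>) \<le> \<bar>\<epsilon> j \<omega>\<bar> * B"
      using elim by (intro mult_left_mono) auto
    moreover have "residual j \<omega> = ((w \<omega> \<bullet> x j \<omega>) *\<^sub>R x j \<omega> - Qbar *v w \<omega>) + \<epsilon> j \<omega> *\<^sub>R x j \<omega>"
      by (simp add: residual_def model_output_def scaleR_left_distrib)
    then have "norm (residual j \<omega>) \<le>
        \<bar>w \<omega> \<bullet> x j \<omega>\<bar> * norm (x j \<omega>) + norm (Qbar *v w \<omega>) + \<bar>\<epsilon> j \<omega>\<bar> * norm (x j \<omega>)"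
      using norm_triangle_ineq[of "(w \<omega> \<bullet> x j \<omega>) *\<^sub>R x j \<omega> - Qbar *v w \<omega>" "\<epsilon> j \<omega> *\<^sub>R x j \<omega>"]
        norm_triangle_ineq4[of "(w \<omega> \<bullet> x j \<omega>) *\<^sub>R x j \<omega>" "Qbar *v w \<omega>"] by simp
    ultimately have "norm (residual j \<omega>) \<le> c * norm (w \<omega>) + B * \<bar>\<epsilon> j \<omega>\<bar>"
      by (simp add: c_def power2_eq_square algebra_simps)
    then have "(norm (residual j \<omega>))\<^sup>2 \<le> (c * norm (w \<omega>) + B * \<bar>\<epsilon> j \<omega>\<bar>)\<^sup>2"
      by (rule power_mono) simp
    also have "\<dots> \<le> 2 * (c * norm (w \<omega>))\<^sup>2 + 2 * (B * \<bar>\<epsilon> j \<omega>\<bar>)\<^sup>2"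
      using norm_sq_add_le[of "c * norm (w \<omega>)" "B * \<bar>\<epsilon> j \<omega>\<bar>"] by simp
    also have "\<dots> = ?R j \<omega>"
      by (simp add: power_mult_distrib)
    finally show ?case .
  qed
  have int_sq: "integrable M (\<lambda>\<omega>. (norm (residual j \<omega>))\<^sup>2)" for j
    by (rule Bochner_Integration.integrable_bound[OF int[of j]]) (use AE[of j] in auto)
  show thesis
  proof (rule that)
    show "sq_integrable M (residual j)" for j
      using int_sq by (simp add: sq_integrable_def)
    have "mean_square M (residual j) \<le> expectation (?R j)" for j
      unfolding mean_square_def by (rule integral_mono_AE[OF int_sq int AE])
    also have "expectation (?R j) = 2 * c\<^sup>2 * mean_square M w + 2 * B\<^sup>2 * \<sigma>\<^sup>2" for j
      using w_sq_integrable noise_sq_integrable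
      by (simp add: sq_integrable_def mean_square_def noise_second_moment)
    finally show "mean_square M (residual j) \<le> 2 * c\<^sup>2 * mean_square M w + 2 * B\<^sup>2 * \<sigma>\<^sup>2" for j .
  qed
qed

lemma input_sq_integrable: "sq_integrable M (x k)"
proof -
  obtain B where B: "0 < B" "\<And>k. AE \<omega> in M. norm (x k \<omega>) \<le> B"
    by (rule input_bounded) blast
  have "AE \<omega> in M. norm ((norm (x k \<omega>))\<^sup>2) \<le> B\<^sup>2"
    using B(2)[of k] by eventually_elim (simp add: power_mono)
  then have "integrable M (\<lambda>\<omega>. (norm (x k \<omega>))\<^sup>2)"
    by (rule integrable_const_bound) simp
  then show ?thesis
    by (simp add: sq_integrable_def)
qed

lemma input_product:
  shows "integrable M (\<lambda>\<omega>. x k \<omega> $ a * x k \<omega> $ b)"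
    and "expectation (\<lambda>\<omega>. x k \<omega> $ a * x k \<omega> $ b) = Qbar $ a $ b"
proof -
  note int = integrable_outer[OF input_sq_integrable[of k]]
  have row: "integrable M (\<lambda>\<omega>. outer (x k \<omega>) (x k \<omega>) $ a)"
    by (rule integrable_bounded_linear[OF bounded_linear_vec_nth int])
  show "integrable M (\<lambda>\<omega>. x k \<omega> $ a * x k \<omega> $ b)"
    using integrable_bounded_linear[OF bounded_linear_vec_nth row, of b] by (simp add: outer_def)
  have "Qbar $ a $ b = expectation (\<lambda>\<omega>. outer (x k \<omega>) (x k \<omega>)) $ a $ b"
    using x_second_moment[of k] by (simp add: second_moment_def)
  also have "\<dots> = expectation (\<lambda>\<omega>. outer (x k \<omega>) (x k \<omega>) $ a $ b)"
    using integral_bounded_linear[OF bounded_linear_vec_nth int, of a]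
      integral_bounded_linear[OF bounded_linear_vec_nth row, of b] by simp
  finally show "expectation (\<lambda>\<omega>. x k \<omega> $ a * x k \<omega> $ b) = Qbar $ a $ b"
    by (simp add: outer_def)
qed

text \<open>Expanding the product of two residuals, each term is a function of \<open>w\<close>, the two inputs and
  the two noises containing a centred factor \<open>Q i - Qbar\<close> or \<open>\<epsilon> i\<close>.\<close>

lemma residual_orthogonal:
  assumes "i \<noteq> j"
  shows "(LINT \<omega>|M. residual i \<omega> \<bullet> residual j \<omega>) = 0"
proof -
  \<comment> \<open>The entries of \<open>Q_k - Qbar\<close>, as centred functions of the input;
    \<open>res\<close> is the residual written in coordinates with them.\<close>
  define q where "q a b v = v $ a * v $ b - Qbar $ a $ b" for a b and v :: "real ^ 'd"
  have res: "residual k \<omega> $ a = (\<Sum>b\<in>UNIV. w \<omega> $ b * q a b (x k \<omega>)) + x k \<omega> $ a * \<epsilon> k \<omega>" for k a \<omega>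
    by (simp add: residual_def model_output_def q_def matrix_vector_mult_def inner_vec_def
        algebra_simps sum_subtractf sum_distrib_left sum_distrib_right)
  have q_meas [measurable]: "q a b \<in> borel_measurable borel" for a b
    unfolding q_def[abs_def] by measurable
  have nth [measurable]: "(\<lambda>v :: real ^ 'd. v $ a) \<in> borel_measurable borel" for a
    by measurable
  have nth2: "(\<lambda>v :: real ^ 'd. v $ a * v $ b) \<in> borel_measurable borel" for a b
    by measurable
  note c1 = borel_measurable_const[of "1 :: real"]
  have idm: "(\<lambda>t :: real. t) \<in> borel_measurable borel"
    by measurable
  have q_int: "integrable M (\<lambda>\<omega>. q a b (x k \<omega>))" "expectation (\<lambda>\<omega>. q a b (x k \<omega>)) = 0" for a b k
    using input_product[of k a b] by (simp_all add: q_def prob_space)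
  have x_int: "integrable M (\<lambda>\<omega>. x k \<omega> $ a)" for k a
    using integrable_of_sq[OF _ sq_integrable_component[OF input_sq_integrable]] by simp
  have w_int: "integrable M (\<lambda>\<omega>. w \<omega> $ a)" for a
    using integrable_of_sq[OF _ sq_integrable_component[OF w_sq_integrable]] by simp
  have ww_int: "integrable M (\<lambda>\<omega>. w \<omega> $ b * w \<omega> $ c)" for b c
    using sq_integrable_component[OF w_sq_integrable] by (intro integrable_mult_of_sq) auto
  have one: "integrable M (\<lambda>_. 1 :: real)"
    by simp
  \<comment> \<open>\<open>t1\<close> to \<open>t4\<close> are the four kinds of term: in
    \<open>t1\<close> both \<open>q\<close> factors are centred, in \<open>t2\<close> and
    \<open>t3\<close> one \<open>q\<close> factor and one noise, in \<open>t4\<close> both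
    noises.\<close>
  have t1: "has_bochner_integral M (\<lambda>\<omega>. w \<omega> $ b * q a b (x i \<omega>) * (w \<omega> $ c * q a c (x j \<omega>))) 0" for a b c
  proof -
    have "has_bochner_integral M (\<lambda>\<omega>. w \<omega> $ b * w \<omega> $ c * q a b (x i \<omega>) * q a c (x j \<omega>)) 0"
      using has_integral_source_product[OF assms,
          of "\<lambda>v. v $ b * v $ c" "q a b" "q a c" "\<lambda>_. 1" "\<lambda>_. 1",
          OF nth2 q_meas q_meas c1 c1 ww_int q_int(1) q_int(1) one one]
      by (simp add: q_int(2) noise_mean)
    then show ?thesis
      by (rule has_bochner_integral_cong[THEN iffD1, rotated -1])
        (simp_all add: mult.assoc mult.left_commute)
  qed
  have t2: "has_bochner_integral M (\<lambda>\<omega>. w \<omega> $ b * q a b (x i \<omega>) * (x j \<omega> $ a * \<epsilon> j \<omega>)) 0" for a b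
  proof -
    have "has_bochner_integral M (\<lambda>\<omega>. w \<omega> $ b * q a b (x i \<omega>) * x j \<omega> $ a * \<epsilon> j \<omega>) 0"
      using has_integral_source_product[OF assms,
          of "\<lambda>v. v $ b" "q a b" "\<lambda>v. v $ a" "\<lambda>_. 1" "\<lambda>t. t",
          OF nth q_meas nth c1 idm w_int q_int(1) x_int one noise_integrable]
      by (simp add: q_int(2) noise_mean)
    then show ?thesis
      by (rule has_bochner_integral_cong[THEN iffD1, rotated -1])
        (simp_all add: mult.assoc mult.left_commute)
  qed
  have t3: "has_bochner_integral M (\<lambda>\<omega>. x i \<omega> $ a * \<epsilon> i \<omega> * (w \<omega> $ c * q a c (x j \<omega>))) 0" for a c
  proof -
    have "has_bochner_integral M (\<lambda>\<omega>. w \<omega> $ c * x i \<omega> $ a * q a c (x j \<omega>) * \<epsilon> i \<omega>) 0"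
      using has_integral_source_product[OF assms,
          of "\<lambda>v. v $ c" "\<lambda>v. v $ a" "q a c" "\<lambda>t. t" "\<lambda>_. 1",
          OF nth nth q_meas idm c1 w_int x_int q_int(1) noise_integrable one]
      by (simp add: q_int(2) noise_mean)
    then show ?thesis
      by (rule has_bochner_integral_cong[THEN iffD1, rotated -1])
        (simp_all add: mult.assoc mult.left_commute)
  qed
  have t4: "has_bochner_integral M (\<lambda>\<omega>. x i \<omega> $ a * \<epsilon> i \<omega> * (x j \<omega> $ a * \<epsilon> j \<omega>)) 0" for a
  proof -
    have "has_bochner_integral M (\<lambda>\<omega>. x i \<omega> $ a * x j \<omega> $ a * \<epsilon> i \<omega> * \<epsilon> j \<omega>) 0"
      using has_integral_source_product[OF assms,
          of "\<lambda>_. 1" "\<lambda>v. v $ a" "\<lambda>v. v $ a" "\<lambda>t. t" "\<lambda>t. t",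
          OF c1 nth nth idm idm one x_int x_int noise_integrable noise_integrable]
      by (simp add: q_int(2) noise_mean)
    then show ?thesis
      by (rule has_bochner_integral_cong[THEN iffD1, rotated -1])
        (simp_all add: mult.assoc mult.left_commute)
  qed
  have "has_bochner_integral M (\<lambda>\<omega>. residual i \<omega> $ a * residual j \<omega> $ a) 0" for a
  proof -
    have "has_bochner_integral M (\<lambda>\<omega>.
        (\<Sum>b\<in>UNIV. \<Sum>c\<in>UNIV. w \<omega> $ b * q a b (x i \<omega>) * (w \<omega> $ c * q a c (x j \<omega>))) +
        (\<Sum>b\<in>UNIV. w \<omega> $ b * q a b (x i \<omega>) * (x j \<omega> $ a * \<epsilon> j \<omega>)) +
        (\<Sum>c\<in>UNIV. x i \<omega> $ a * \<epsilon> i \<omega> * (w \<omega> $ c * q a c (x j \<omega>))) +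
        x i \<omega> $ a * \<epsilon> i \<omega> * (x j \<omega> $ a * \<epsilon> j \<omega>))
        ((\<Sum>b\<in>(UNIV :: 'd set). \<Sum>c\<in>(UNIV :: 'd set). 0) + (\<Sum>b\<in>(UNIV :: 'd set). 0) +
          (\<Sum>c\<in>(UNIV :: 'd set). 0) + 0)"
      by (intro has_bochner_integral_add has_bochner_integral_sum t1 t2 t3 t4)
    then show ?thesis
      unfolding res sum_add_product by simp
  qed
  then have "has_bochner_integral M (\<lambda>\<omega>. \<Sum>a\<in>UNIV. residual i \<omega> $ a * residual j \<omega> $ a)
      (\<Sum>a\<in>(UNIV :: 'd set). 0)"
    by (intro has_bochner_integral_sum)
  then show ?thesis
    by (simp add: inner_vec_def has_bochner_integral_iff)
qed

text \<open>The method of moments: \<open>Qbar w\<close> is replaced by the sample mean of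
  \<open>y_j x_j\<close> and the equation is solved for \<open>w\<close>. At time \<open>k\<close>
  there are \<open>Suc k\<close> samples, all part of the information.\<close>

definition moment_estimate :: "nat \<Rightarrow> 'a \<Rightarrow> real ^ 'd" where
  "moment_estimate k \<omega> =
     matrix_inv Qbar *v ((1 / real (Suc k)) *\<^sub>R (\<Sum>j<Suc k. model_output w x \<epsilon> j \<omega> *\<^sub>R x j \<omega>))"

lemma moment_estimate_error:
  "moment_estimate k \<omega> - w \<omega> =
     matrix_inv Qbar *v ((1 / real (Suc k)) *\<^sub>R (\<Sum>j<Suc k. residual j \<omega>))"
proof -
  have "matrix_inv Qbar *v (Qbar *v w \<omega>) = w \<omega>"
    by (simp add: matrix_vector_mul_assoc pd_matrix_inverse(1)[OF Qbar_pd])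
  moreover have "(1 / real (Suc k)) *\<^sub>R (\<Sum>j<Suc k. residual j \<omega>) =
      (1 / real (Suc k)) *\<^sub>R (\<Sum>j<Suc k. model_output w x \<epsilon> j \<omega> *\<^sub>R x j \<omega>) - Qbar *v w \<omega>"
    by (simp add: residual_def sum_subtractf scaleR_diff_right sum_constant_scaleR
        del: sum_constant sum.lessThan_Suc of_nat_Suc)
  ultimately show ?thesis
    by (simp add: moment_estimate_def matrix_vector_mult_diff_distrib del: sum.lessThan_Suc)
qed

text \<open>The sum of \<open>n = k + 1\<close> orthogonal residuals has mean square at most
  \<open>n C\<close>; averaging divides this by \<open>n^2\<close>, and \<open>Qbar^-1\<close>
  contributes its squared operator norm.\<close>

lemma moment_estimate_consistent:
  obtains C where "\<And>k. mean_square M (\<lambda>\<omega>. moment_estimate k \<omega> - w \<omega>) \<le> C / real (Suc k)"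
    and "\<And>k. sq_integrable M (moment_estimate k)"
proof -
  obtain C where C: "\<And>j. sq_integrable M (residual j)" "\<And>j. mean_square M (residual j) \<le> C"
    by (rule residual_bound) blast
  let ?S = "\<lambda>k \<omega>. \<Sum>j<Suc k. residual j \<omega>"
  note S = mean_square_sum_orthogonal[OF C(1) residual_orthogonal C(2)]
  let ?o = "onorm ((*v) (matrix_inv Qbar))"
  have sq: "sq_integrable M (\<lambda>\<omega>. moment_estimate k \<omega> - w \<omega>)" for k
    unfolding moment_estimate_error
    by (intro sq_integrable_matrix_mult sq_integrable_scaleR S(2))
  show thesis
  proof (rule that)
    show "sq_integrable M (moment_estimate k)" for k
      using sq_integrable_add[OF sq[of k] w_sq_integrable] by simp
    show "mean_square M (\<lambda>\<omega>. moment_estimate k \<omega> - w \<omega>) \<le> ?o\<^sup>2 * C / real (Suc k)" for k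
    proof -
      have "mean_square M (\<lambda>\<omega>. moment_estimate k \<omega> - w \<omega>) \<le>
          (?o / real (Suc k))\<^sup>2 * mean_square M (?S k)"
      proof (rule mean_square_mono[OF S(2) sq])
        show "0 \<le> ?o / real (Suc k)"
          by (simp add: onorm_pos_le)
        show "norm (moment_estimate k \<omega> - w \<omega>) \<le> ?o / real (Suc k) * norm (?S k \<omega>)" for \<omega>
          unfolding moment_estimate_error
          using onorm[of "(*v) (matrix_inv Qbar)" "(1 / real (Suc k)) *\<^sub>R ?S k \<omega>"]
          by (simp del: sum.lessThan_Suc of_nat_Suc)
      qed
      also have "\<dots> \<le> (?o / real (Suc k))\<^sup>2 * (real (Suc k) * C)"
        by (intro mult_left_mono S(1)) auto
      also have "\<dots> = ?o\<^sup>2 * C / real (Suc k)"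
        by (simp add: power2_eq_square field_simps del: of_nat_Suc)
      finally show ?thesis .
    qed
  qed
qed

subsection \<open>Estimates and filtration\<close>

abbreviation info :: "(nat \<Rightarrow> 'a \<Rightarrow> real ^ 'd) \<Rightarrow> nat \<Rightarrow> 'a measure" where
  "info u k \<equiv> information M x (model_output w x \<epsilon>) u k"

text \<open>The side condition under which \<open>sigma\<close> really has the generated
  sigma-algebra as its sets.\<close>

lemma information_generators:
  "{x j -` A \<inter> space M |j A. j \<le> k \<and> A \<in> sets borel} \<union>
   {model_output w x \<epsilon> j -` A \<inter> space M |j A. j \<le> k \<and> A \<in> sets borel} \<union>
   {u j -` A \<inter> space M |j A. j < k \<and> A \<in> sets borel} \<subseteq> Pow (space M)"
  by auto

text \<open>Only updates before time \<open>k\<close> enter the generators, so their measurability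
  can be supplied by induction over time.\<close>

lemma subalgebra_information:
  assumes "\<forall>j<k. u j \<in> borel_measurable M"
  shows "subalgebra M (info u k)"
  unfolding subalgebra_def information_def
  using assms information_generators[of k u]
  by (auto simp: space_measure_of_conv sets_measure_of_conv intro!: sets.sigma_sets_subset)

lemma information_measurable:
  shows "j \<le> k \<Longrightarrow> x j \<in> borel_measurable (info u k)"
    and "j \<le> k \<Longrightarrow> model_output w x \<epsilon> j \<in> borel_measurable (info u k)"
    and "j < k \<Longrightarrow> u j \<in> borel_measurable (info u k)"
  unfolding information_def
  using information_generators[of k u]
  by (auto simp: measurable_def space_measure_of_conv sets_measure_of_conv intro!: sigma_sets.Basic)

lemma moment_estimate_measurable: "moment_estimate k \<in> borel_measurable (info u k)"
proof -
  have "(\<lambda>\<omega>. \<Sum>j<Suc k. model_output w x \<epsilon> j \<omega> *\<^sub>R x j \<omega>) \<in> borel_measurable (info u k)"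
    by (intro borel_measurable_sum borel_measurable_scaleR information_measurable) auto
  then show ?thesis
    unfolding moment_estimate_def[abs_def] by measurable
qed

text \<open>The estimate at time \<open>k\<close> is the sum of the updates before \<open>k\<close>,
  which are among the generators.\<close>

lemma estimate_measurable: "estimate u k \<in> borel_measurable (info u k)"
proof -
  have "estimate u k = (\<lambda>\<omega>. \<Sum>j<k. u j \<omega>)"
    by (induction k) auto
  then show ?thesis
    using information_measurable(3) by (auto intro!: borel_measurable_sum)
qed

lemma kalman_error_sq_integrable:
  assumes "\<forall>j<k. u j \<in> borel_measurable M"
  shows "sq_integrable M (kalman_error M w x \<epsilon> u k)" "expectation (kalman_error M w x \<epsilon> u k) = 0"
proof -
  note V = vec_cond_exp_L2[OF subalgebra_information[OF assms] w_sq_integrable]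
  show "sq_integrable M (kalman_error M w x \<epsilon> u k)"
    unfolding kalman_error_def by (intro sq_integrable_diff V(1) w_sq_integrable)
  show "expectation (kalman_error M w x \<epsilon> u k) = 0"
    unfolding kalman_error_def
    using V(3) sq_integrable_integrable[OF V(1)] sq_integrable_integrable[OF w_sq_integrable]
    by (simp add: w_mean)
qed

text \<open>The moment estimator is a function of the information, so the conditional mean is at
  most four times worse in mean square; the error lies between 0 and
  \<open>4 C / (k + 1)\<close>.\<close>

lemma kalman_error_tendsto_0:
  assumes "\<And>j. u j \<in> borel_measurable M"
  shows "(\<lambda>k. mean_square M (kalman_error M w x \<epsilon> u k)) \<longlonglongrightarrow> 0"
proof -
  obtain C where C: "\<And>k. mean_square M (\<lambda>\<omega>. moment_estimate k \<omega> - w \<omega>) \<le> C / real (Suc k)"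
    "\<And>k. sq_integrable M (moment_estimate k)"
    by (rule moment_estimate_consistent) blast
  have F: "subalgebra M (info u k)" for k
    by (rule subalgebra_information) (simp add: assms)
  have bound: "mean_square M (kalman_error M w x \<epsilon> u k) \<le> 4 * (C / real (Suc k))" for k
    unfolding kalman_error_def
    by (rule order_trans[OF mean_square_cond_exp_error_le[OF F w_sq_integrable C(2)
            moment_estimate_measurable]]) (intro mult_left_mono C(1) zero_le_numeral)
  have "(\<lambda>k. C / real (Suc k)) \<longlonglongrightarrow> 0"
    by (rule LIMSEQ_Suc[OF lim_const_over_n])
  then have lim: "(\<lambda>k. 4 * (C / real (Suc k))) \<longlonglongrightarrow> 0"
    by (rule tendsto_mult_right_zero)
  show ?thesis
    by (rule tendsto_sandwich[OF _ _ tendsto_const lim])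
      (intro always_eventually allI mean_square_nonneg bound)+
qed

subsection \<open>The OLL recursion\<close>

text \<open>The three claims need one joint induction: measurable past updates make the information
  a subalgebra, a square-integrable error makes its conditional expectation, and hence
  \<open>u k\<close>, square integrable, and zero mean passes to \<open>u k\<close>. The bound
  \<open>n\<close> covers both the finite horizon and \<open>T = UNIV\<close>.\<close>

lemma oll_estimate:
  assumes "oll_updates M w x \<epsilon> L T u" "{..<n} \<subseteq> T" "k \<le> n"
  shows "sq_integrable M (estimate u k)" "expectation (est_error w u k) = 0"
    and "\<forall>j<k. u j \<in> borel_measurable M"
proof -
  have "sq_integrable M (estimate u k) \<and> expectation (est_error w u k) = 0 \<and>
      (\<forall>j<k. u j \<in> borel_measurable M)"
    using \<open>k \<le> n\<close>
  proof (induction k)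
    case 0
    then show ?case
      by (simp add: est_error_def w_mean sq_integrable_def)
  next
    case (Suc k)
    then have IH: "sq_integrable M (estimate u k)" "expectation (est_error w u k) = 0"
      "\<forall>j<k. u j \<in> borel_measurable M"
      by auto
    from Suc.prems assms(2) have "k \<in> T"
      by auto
    then have u: "u k \<in> borel_measurable (info u k)"
      "AE \<omega> in M. u k \<omega> = L k *v vec_cond_exp M (info u k) (est_error w u k) \<omega>"
      using assms(1) by (auto simp: oll_updates_def)
    note F = subalgebra_information[OF IH(3)]
    have e: "sq_integrable M (est_error w u k)"
      unfolding est_error_def by (intro sq_integrable_diff IH(1) w_sq_integrable)
    note V = vec_cond_exp_L2[OF F e]
    have u_meas: "u k \<in> borel_measurable M"
      using measurable_from_subalg[OF F u(1)] .
    have u_sq: "sq_integrable M (u k)"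
      by (rule sq_integrable_cong_AE[OF sq_integrable_matrix_mult[OF V(1)] u_meas u(2)])
    have "expectation (u k) = expectation (\<lambda>\<omega>. L k *v vec_cond_exp M (info u k) (est_error w u k) \<omega>)"
      using u_meas sq_integrable_measurable[OF V(1)] u(2)
      by (intro integral_cong_AE measurable_matrix_vector_mult) auto
    also have "\<dots> = L k *v expectation (vec_cond_exp M (info u k) (est_error w u k))"
      by (rule integral_bounded_linear[OF matrix_vector_mul_bounded_linear sq_integrable_integrable[OF V(1)]])
    finally have "expectation (u k) = 0"
      using V(3) IH(2) by simp
    moreover have "est_error w u (Suc k) = (\<lambda>\<omega>. est_error w u k \<omega> + u k \<omega>)"
      by (simp add: est_error_def fun_eq_iff)
    ultimately have "expectation (est_error w u (Suc k)) = 0"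
      using IH(2) sq_integrable_integrable[OF e] sq_integrable_integrable[OF u_sq] by simp
    then show ?case
      using sq_integrable_add[OF IH(1) u_sq] IH(3) u_meas by (auto simp: less_Suc_eq)
  qed
  then show "sq_integrable M (estimate u k)" "expectation (est_error w u k) = 0"
    "\<forall>j<k. u j \<in> borel_measurable M"
    by auto
qed

lemma oll_error_sq_integrable:
  assumes "oll_updates M w x \<epsilon> L T u" "{..<n} \<subseteq> T" "k \<le> n"
  shows "sq_integrable M (est_error w u k)"
  unfolding est_error_def by (intro sq_integrable_diff oll_estimate(1)[OF assms] w_sq_integrable)

lemma mse_eq_mean_square: "mse M w u k = mean_square M (est_error w u k)"
  by (simp add: mse_def mean_square_def est_error_def power2_norm_eq_inner[symmetric] norm_minus_commute)

lemma oll_mse_eq_trace: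
  assumes "oll_updates M w x \<epsilon> L T u" "{..<n} \<subseteq> T" "k \<le> n"
  shows "mse M w u k = trace (covariance M (est_error w u k))"
  using trace_covariance[OF oll_error_sq_integrable[OF assms] oll_estimate(2)[OF assms]]
  by (simp add: mse_eq_mean_square)

text \<open>The estimate is known given the information, so the conditional expectation of the error
  is the estimate minus the conditional mean of \<open>w\<close>, that is, the OLL error minus the
  Kalman error. Multiplying by \<open>L k\<close> and adding the old error gives the
  recursion.\<close>

lemma oll_error_step:
  assumes oll: "oll_updates M w x \<epsilon> L T u" "{..<n} \<subseteq> T" and "k < n"
  shows "AE \<omega> in M. est_error w u (Suc k) \<omega> =
    (mat 1 + L k) *v est_error w u k \<omega> + - (L k *v kalman_error M w x \<epsilon> u k \<omega>)"
proof -
  from \<open>k < n\<close> have "k \<le> n" "k \<in> T"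
    using oll(2) by auto
  note E = oll_estimate[OF oll \<open>k \<le> n\<close>]
  have "AE \<omega> in M. u k \<omega> = L k *v vec_cond_exp M (info u k) (est_error w u k) \<omega>"
    using oll(1) \<open>k \<in> T\<close> by (auto simp: oll_updates_def)
  moreover have "AE \<omega> in M. vec_cond_exp M (info u k) (est_error w u k) \<omega> =
      estimate u k \<omega> - vec_cond_exp M (info u k) w \<omega>"
    unfolding est_error_def
    by (rule vec_cond_exp_diff_measurable[OF subalgebra_information[OF E(3)] w_sq_integrable E(1)
          estimate_measurable])
  ultimately show ?thesis
    by eventually_elim (simp add: est_error_def kalman_error_def matrix_vector_mult_add_rdistrib
        matrix_vector_mult_diff_distrib)
qed

text \<open>Minkowski's inequality applied to the error recursion, in squared form for (ii) and in
  root form for (iii).\<close>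

lemma oll_mse_step:
  assumes oll: "oll_updates M w x \<epsilon> L T u" "{..<n} \<subseteq> T" and "k < n"
  defines "a \<equiv> mean_square M (\<lambda>\<omega>. (mat 1 + L k) *v est_error w u k \<omega>)"
    and "b \<equiv> mean_square M (\<lambda>\<omega>. L k *v kalman_error M w x \<epsilon> u k \<omega>)"
  shows "mse M w u (Suc k) \<le> a + b + 2 * sqrt (a * b)"
    and "sqrt (mse M w u (Suc k)) \<le> sqrt a + sqrt b"
proof -
  from \<open>k < n\<close> have "k \<le> n" "Suc k \<le> n"
    by auto
  note X = sq_integrable_matrix_mult[OF oll_error_sq_integrable[OF oll \<open>k \<le> n\<close>], of "mat 1 + L k"]
  note Y = sq_integrable_uminus[OF sq_integrable_matrix_mult
      [OF kalman_error_sq_integrable(1)[OF oll_estimate(3)[OF oll \<open>k \<le> n\<close>]], of "L k"]]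
  have b: "mean_square M (\<lambda>\<omega>. - (L k *v kalman_error M w x \<epsilon> u k \<omega>)) = b"
    by (simp add: b_def mean_square_def)
  have "mse M w u (Suc k) = mean_square M (\<lambda>\<omega>. (mat 1 + L k) *v est_error w u k \<omega> +
      - (L k *v kalman_error M w x \<epsilon> u k \<omega>))"
    unfolding mse_eq_mean_square mean_square_def
  proof (rule integral_cong_AE)
    show "AE \<omega> in M. (norm (est_error w u (Suc k) \<omega>))\<^sup>2 =
        (norm ((mat 1 + L k) *v est_error w u k \<omega> + - (L k *v kalman_error M w x \<epsilon> u k \<omega>)))\<^sup>2"
      using oll_error_step[OF oll \<open>k < n\<close>] by eventually_elim simp
  qed (use oll_error_sq_integrable[OF oll \<open>Suc k \<le> n\<close>] sq_integrable_add[OF X Y] in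
      \<open>auto simp: sq_integrable_def\<close>)
  then show "mse M w u (Suc k) \<le> a + b + 2 * sqrt (a * b)"
    "sqrt (mse M w u (Suc k)) \<le> sqrt a + sqrt b"
    using mean_square_Minkowski[OF X Y] sqrt_mean_square_add_le[OF X Y] by (simp_all add: a_def b)
qed

lemma oll_mse_bound:
  assumes oll: "oll_updates M w x \<epsilon> L T u" "{..<n} \<subseteq> T" and "1 \<le> k" "k \<le> n"
  shows "let a = trace ((mat 1 + L (k - 1)) ** covariance M (est_error w u (k - 1))
                ** transpose (mat 1 + L (k - 1)));
             b = trace (L (k - 1) ** covariance M (kalman_error M w x \<epsilon> u (k - 1))
                ** transpose (L (k - 1)))
         in mse M w u k \<le> a + b + 2 * sqrt (a * b)"
proof -
  obtain l where l: "k = Suc l" "l < n" "l \<le> n"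
    using \<open>1 \<le> k\<close> \<open>k \<le> n\<close> by (cases k) auto
  note E = oll_estimate[OF oll \<open>l \<le> n\<close>]
  show ?thesis
    using oll_mse_step(1)[OF oll \<open>l < n\<close>]
    by (simp add: l(1) trace_matrix_covariance[OF oll_error_sq_integrable[OF oll \<open>l \<le> n\<close>] E(2)]
        trace_matrix_covariance[OF kalman_error_sq_integrable[OF E(3)]])
qed

end

section \<open>The stationary gain\<close>

text \<open>\<open>I + L\<close> shrinks every nonzero vector strictly, and compactness of the unit
  sphere makes the factor uniform.\<close>

lemma stationary_gain_contraction:
  fixes K Q :: "real ^ 'd ^ 'd"
  assumes K: "stationary_riccati \<gamma> Q K" and Q: "pd_matrix Q" and \<gamma>: "0 < \<gamma>"
  obtains r where "0 \<le> r" "r < 1" "\<And>v. norm ((mat 1 + gain \<gamma> K) *v v) \<le> r * norm v"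
proof -
  let ?A = "K + \<gamma> *\<^sub>R mat 1" and ?P = "mat 1 + gain \<gamma> K"
  have psd: "0 \<le> v \<bullet> (K *v v)" for v
    using K unfolding stationary_riccati_def psd_matrix_def by blast
  have sym: "transpose K = K"
    using K unfolding stationary_riccati_def psd_matrix_def by blast
  have riccati: "K = K - K ** matrix_inv ?A ** K + Q"
    using K unfolding stationary_riccati_def riccati_step_def by blast
  have A_mult: "?A *v v = K *v v + \<gamma> *\<^sub>R v" for v
    by (simp add: matrix_vector_mult_add_rdistrib scaleR_matrix_vector_assoc[symmetric])
  have "pd_matrix ?A"
    unfolding pd_matrix_def
  proof (intro conjI allI impI)
    show "transpose ?A = ?A"
      using sym by (auto simp: transpose_def vec_eq_iff mat_def)
    fix v :: "real ^ 'd" assume "v \<noteq> 0"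
    then show "0 < v \<bullet> (?A *v v)"
      using psd[of v] \<gamma> by (simp add: A_mult inner_add_right add_nonneg_pos)
  qed
  note A_inv = pd_matrix_inverse[OF this]
  \<comment> \<open>This is \<open>I + L = \<gamma> (K + \<gamma> I)^-1\<close>, multiplied through
    by \<open>K + \<gamma> I\<close>.\<close>
  have AP: "?A *v (?P *v v) = \<gamma> *\<^sub>R v" for v
  proof -
    have "?P *v v = v - matrix_inv ?A *v (K *v v)"
      by (simp add: gain_def matrix_vector_mult_diff_rdistrib matrix_vector_mul_assoc)
    then have "?A *v (?P *v v) = ?A *v v - (?A ** matrix_inv ?A) *v (K *v v)"
      by (simp add: matrix_vector_mult_diff_distrib matrix_vector_mul_assoc matrix_mul_assoc)
    then show ?thesis
      by (simp add: A_inv A_mult)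
  qed
  have strict: "norm (?P *v v) < norm v" if "v \<noteq> 0" for v
  proof -
    let ?p = "?P *v v"
    have Kp: "K *v ?p = \<gamma> *\<^sub>R (v - ?p)"
      using AP[of v] unfolding A_mult by (metis add_diff_cancel_right' scaleR_diff_right)
    then have ge: "0 \<le> ?p \<bullet> (v - ?p)"
      using psd[of ?p] \<gamma> by (simp add: zero_le_mult_iff)
    \<comment> \<open>Source of strictness: if \<open>v\<close> were fixed, then
      \<open>K v = 0\<close>, and the Riccati equation applied to \<open>v\<close> would collapse to
      \<open>Q v = 0\<close>.\<close>
    have "v - ?p \<noteq> 0"
    proof
      assume eq: "v - ?p = 0"
      then have pv: "?p = v"
        by (rule right_minus_eq[THEN iffD1, symmetric])
      have "K *v ?p = 0"
        unfolding Kp eq by (rule scaleR_zero_right)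
      then have Kv: "K *v v = 0"
        unfolding pv .
      have "K *v v = (K - K ** matrix_inv ?A ** K + Q) *v v"
        using riccati by (rule arg_cong)
      also have "\<dots> = K *v v - K *v (matrix_inv ?A *v (K *v v)) + Q *v v"
        by (simp only: matrix_vector_mult_add_rdistrib matrix_vector_mult_diff_rdistrib
            matrix_vector_mul_assoc matrix_mul_assoc)
      finally have "Q *v v = 0"
        unfolding Kv by simp
      then show False
        using Q \<open>v \<noteq> 0\<close> unfolding pd_matrix_def by (metis inner_zero_right less_irrefl)
    qed
    then have "0 < (norm (v - ?p))\<^sup>2"
      by simp
    moreover have "(norm a)\<^sup>2 = (norm b)\<^sup>2 + 2 * (b \<bullet> (a - b)) + (norm (a - b))\<^sup>2" for a b :: "real ^ 'd"
      by (simp add: power2_norm_eq_inner inner_diff_left inner_diff_right inner_commute)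
    from this[of v ?p] ge calculation have "(norm ?p)\<^sup>2 < (norm v)\<^sup>2"
      by linarith
    then show ?thesis
      by (rule power_less_imp_less_base) simp
  qed
  \<comment> \<open>The maximum of the norm over the unit sphere is attained, hence below 1; it
    serves as \<open>r\<close>, and scaling extends the bound to all vectors.\<close>
  have "continuous_on (sphere 0 1) (\<lambda>v. norm (?P *v v))"
    by (intro continuous_on_norm linear_continuous_on) simp
  moreover have "sphere (0 :: real ^ 'd) 1 \<noteq> {}"
    by simp
  ultimately obtain z where z: "z \<in> sphere 0 1"
    "\<And>v. v \<in> sphere 0 1 \<Longrightarrow> norm (?P *v v) \<le> norm (?P *v z)"
    using continuous_attains_sup[OF compact_sphere] by metis
  show thesis
  proof (rule that)
    show "0 \<le> norm (?P *v z)"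
      by simp
    show "norm (?P *v z) < 1"
    proof -
      have "norm z = 1" "z \<noteq> 0"
        using z(1) by auto
      then show ?thesis
        using strict[of z] by simp
    qed
    show "norm (?P *v v) \<le> norm (?P *v z) * norm v" for v
    proof (cases "v = 0")
      case False
      then have "norm (?P *v (v /\<^sub>R norm v)) \<le> norm (?P *v z)"
        by (intro z(2)) simp
      then have "norm (?P *v (v /\<^sub>R norm v)) * norm v \<le> norm (?P *v z) * norm v"
        by (rule mult_right_mono) simp
      moreover have "norm (?P *v (v /\<^sub>R norm v)) * norm v = norm (?P *v v)"
        unfolding matrix_vector_mult_scaleR using False by simp
      ultimately show ?thesis
        by (simp only:)
    qed simp
  qed
qed

text \<open>Once the perturbation is small, the recursion is trapped below a geometric term plus
  \<open>e / 2\<close>.\<close>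

lemma contraction_perturbed_tendsto_0:
  fixes s t :: "nat \<Rightarrow> real"
  assumes step: "\<And>k. s (Suc k) \<le> r * s k + t k" and nonneg: "\<And>k. 0 \<le> s k"
    and r: "0 \<le> r" "r < 1" and t: "t \<longlonglongrightarrow> 0"
  shows "s \<longlonglongrightarrow> 0"
proof (rule LIMSEQ_I)
  fix e :: real assume e: "0 < e"
  \<comment> \<open>Chosen so that \<open>e / 2\<close> is the fixed point of
    \<open>s -> r s + ?d\<close>.\<close>
  let ?d = "(1 - r) * (e / 2)"
  have "0 < ?d"
    using e r by simp
  then obtain n where n: "\<And>k. n \<le> k \<Longrightarrow> norm (t k - 0) < ?d"
    using LIMSEQ_D[OF t] by metis
  have bound: "s (n + m) \<le> r ^ m * s n + e / 2" for m
  proof (induction m)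
    case 0
    then show ?case
      using e by simp
  next
    case (Suc m)
    have "s (n + Suc m) \<le> r * s (n + m) + ?d"
      using step[of "n + m"] n[of "n + m"] by simp
    also have "\<dots> \<le> r * (r ^ m * s n + e / 2) + ?d"
      using Suc r by (intro add_right_mono mult_left_mono) auto
    also have "\<dots> = r ^ Suc m * s n + e / 2"
      by (simp add: field_simps)
    finally show ?case .
  qed
  have "(\<lambda>m. r ^ m * s n) \<longlonglongrightarrow> 0"
    using LIMSEQ_power_zero[of r] r by (intro tendsto_mult_left_zero) auto
  then obtain m where m: "\<And>k. m \<le> k \<Longrightarrow> norm (r ^ k * s n - 0) < e / 2"
    using LIMSEQ_D[of _ 0 "e / 2"] e by (metis half_gt_zero)
  show "\<exists>N. \<forall>k\<ge>N. norm (s k - 0) < e"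
  proof (intro exI[of _ "n + m"] allI impI)
    fix k assume "n + m \<le> k"
    then have "n + (k - n) = k" "m \<le> k - n"
      by auto
    with bound[of "k - n"] m[of "k - n"] nonneg[of k] show "norm (s k - 0) < e"
      by simp
  qed
qed

text \<open>The root mean square errors satisfy a contraction with factor \<open>r\<close>,
  perturbed by the root mean square Kalman error times the operator norm of the gain, which tends to
  0.\<close>

lemma (in data_model) oll_stationary_mse_tendsto_0:
  assumes K: "stationary_riccati \<gamma> Qbar K" and \<gamma>: "0 < \<gamma>" and L: "\<And>k. L k = gain \<gamma> K"
    and oll: "oll_updates M w x \<epsilon> L UNIV u"
  shows "(\<lambda>k. mse M w u k) \<longlonglongrightarrow> 0"
proof -
  obtain r where r: "0 \<le> r" "r < 1" "\<And>v. norm ((mat 1 + gain \<gamma> K) *v v) \<le> r * norm v"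
    using stationary_gain_contraction[OF K Qbar_pd \<gamma>] by blast
  let ?o = "onorm ((*v) (gain \<gamma> K))"
  let ?t = "\<lambda>k. mean_square M (kalman_error M w x \<epsilon> u k)"
  have meas: "u j \<in> borel_measurable M" for j
    using oll_estimate(3)[OF oll subset_UNIV order_refl, of "Suc j"] by simp
  have step: "sqrt (mse M w u (Suc k)) \<le> r * sqrt (mse M w u k) + ?o * sqrt (?t k)" for k
  proof -
    have e: "sq_integrable M (est_error w u k)"
      by (rule oll_error_sq_integrable[OF oll subset_UNIV order_refl])
    have "mean_square M (\<lambda>\<omega>. (mat 1 + L k) *v est_error w u k \<omega>) \<le> r\<^sup>2 * mse M w u k"
      unfolding L mse_eq_mean_square
      by (rule mean_square_mono[OF e sq_integrable_matrix_mult[OF e] r(1) r(3)])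
    then have "sqrt (mean_square M (\<lambda>\<omega>. (mat 1 + L k) *v est_error w u k \<omega>)) \<le> r * sqrt (mse M w u k)"
      using real_sqrt_le_mono r(1) by (fastforce simp: real_sqrt_mult)
    moreover
    have "mean_square M (\<lambda>\<omega>. L k *v kalman_error M w x \<epsilon> u k \<omega>) \<le> ?o\<^sup>2 * ?t k"
      unfolding L using kalman_error_sq_integrable(1)[of k u] meas
      by (intro mean_square_mono sq_integrable_matrix_mult) (auto simp: onorm onorm_pos_le)
    then have "sqrt (mean_square M (\<lambda>\<omega>. L k *v kalman_error M w x \<epsilon> u k \<omega>)) \<le> ?o * sqrt (?t k)"
      using real_sqrt_le_mono by (fastforce simp: real_sqrt_mult onorm_pos_le)
    ultimately show ?thesis
      using oll_mse_step(2)[OF oll subset_UNIV lessI, of k] by linarith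
  qed
  have "(\<lambda>k. ?o * sqrt (?t k)) \<longlonglongrightarrow> ?o * sqrt 0"
    by (intro tendsto_mult_left tendsto_real_sqrt kalman_error_tendsto_0 meas)
  then have "(\<lambda>k. sqrt (mse M w u k)) \<longlonglongrightarrow> 0"
    by (intro contraction_perturbed_tendsto_0[where s = "\<lambda>k. sqrt (mse M w u k)", OF step _ r(1,2)])
      (auto simp: mse_eq_mean_square mean_square_nonneg)
  then have "(\<lambda>k. (sqrt (mse M w u k))\<^sup>2) \<longlonglongrightarrow> 0\<^sup>2"
    by (rule tendsto_power)
  then show ?thesis
    by (simp add: mse_eq_mean_square mean_square_nonneg)
qed

theorem proposition6:
  fixes M :: "'a measure"
    and w :: "'a \<Rightarrow> real ^ 'd"
    and x :: "nat \<Rightarrow> 'a \<Rightarrow> real ^ 'd"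
    and \<epsilon> :: "nat \<Rightarrow> 'a \<Rightarrow> real"
    and \<Sigma>w Qbar :: "real ^ 'd ^ 'd"
    and \<sigma> \<gamma> :: real
  assumes "data_model M w x \<epsilon> \<Sigma>w \<sigma> Qbar"
    and "0 < \<gamma>"
  shows
    "(\<forall>N K L u. 1 \<le> N \<and> finite_horizon_riccati M x \<gamma> N K \<and>
        (\<forall>k<N. L k = gain \<gamma> (K (k + 1))) \<and> oll_updates M w x \<epsilon> L {..<N} u \<longrightarrow>
        (\<forall>k\<le>N. mse M w u k = trace (covariance M (est_error w u k))) \<and>
        (\<forall>k. 1 \<le> k \<and> k \<le> N \<longrightarrow>
          (let a = trace ((mat 1 + L (k - 1)) ** covariance M (est_error w u (k - 1))
                     ** transpose (mat 1 + L (k - 1)));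
               b = trace (L (k - 1) ** covariance M (kalman_error M w x \<epsilon> u (k - 1))
                     ** transpose (L (k - 1)))
           in mse M w u k \<le> a + b + 2 * sqrt (a * b))))
     \<and>
     (\<forall>K L u. stationary_riccati \<gamma> Qbar K \<and> (\<forall>k. L k = gain \<gamma> K) \<and>
        oll_updates M w x \<epsilon> L UNIV u \<longrightarrow>
        (\<forall>k. mse M w u k = trace (covariance M (est_error w u k))) \<and>
        (\<forall>k\<ge>1.
          (let a = trace ((mat 1 + L (k - 1)) ** covariance M (est_error w u (k - 1))
                     ** transpose (mat 1 + L (k - 1)));
               b = trace (L (k - 1) ** covariance M (kalman_error M w x \<epsilon> u (k - 1))
                     ** transpose (L (k - 1)))
           in mse M w u k \<le> a + b + 2 * sqrt (a * b))) \<and>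
        (\<lambda>k. mse M w u k) \<longlonglongrightarrow> 0)"
proof -
  interpret data_model M w x \<epsilon> \<Sigma>w \<sigma> Qbar
    by fact
  show ?thesis
  proof (intro conjI allI impI; (elim conjE)?)
    \<comment> \<open>The \<open>N\<close> updates at times below \<open>N\<close> determine the
      estimates at times 0 to \<open>N\<close>, so \<open>k = N\<close> is included.\<close>
    fix N K L u and k :: nat
    assume oll: "oll_updates M w x \<epsilon> L {..<N} u" and "k \<le> N"
    then show "mse M w u k = trace (covariance M (est_error w u k))"
      by (intro oll_mse_eq_trace[OF oll order_refl])
  next
    fix N K L u and k :: nat
    assume oll: "oll_updates M w x \<epsilon> L {..<N} u" and "1 \<le> k" "k \<le> N"
    then show "let a = trace ((mat 1 + L (k - 1)) ** covariance M (est_error w u (k - 1))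
                     ** transpose (mat 1 + L (k - 1)));
               b = trace (L (k - 1) ** covariance M (kalman_error M w x \<epsilon> u (k - 1))
                     ** transpose (L (k - 1)))
           in mse M w u k \<le> a + b + 2 * sqrt (a * b)"
      by (intro oll_mse_bound[OF oll order_refl])
  next
    fix K L u and k :: nat
    assume oll: "oll_updates M w x \<epsilon> L UNIV u"
    then show "mse M w u k = trace (covariance M (est_error w u k))"
      by (intro oll_mse_eq_trace[OF oll subset_UNIV order_refl])
  next
    fix K L u and k :: nat
    assume oll: "oll_updates M w x \<epsilon> L UNIV u" and "1 \<le> k"
    then show "let a = trace ((mat 1 + L (k - 1)) ** covariance M (est_error w u (k - 1))
                     ** transpose (mat 1 + L (k - 1)));
               b = trace (L (k - 1) ** covariance M (kalman_error M w x \<epsilon> u (k - 1))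
                     ** transpose (L (k - 1)))
           in mse M w u k \<le> a + b + 2 * sqrt (a * b)"
      by (intro oll_mse_bound[OF oll subset_UNIV _ order_refl])
  next
    fix K L u
    assume "oll_updates M w x \<epsilon> L UNIV u" "stationary_riccati \<gamma> Qbar K" "\<forall>k. L k = gain \<gamma> K"
    then show "(\<lambda>k. mse M w u k) \<longlonglongrightarrow> 0"
      by (intro oll_stationary_mse_tendsto_0[OF _ \<open>0 < \<gamma>\<close>]) auto
  qed
qed

end
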